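(* Let $n \ge 6$, let $d_n(q)=\sum_{\pi\in D_n} q^{\mathrm{maj}(\pi)}$, let $\beta_n$ be its degree, and write $d_n(q)=\sum_{k=1}^{\beta_n} A_n(k)q^k$. Then: 1. If $n\equiv 1 \pmod 4$, let $r=\frac{n(n-1)}{4}$. Then $\frac{A_n(1)}{A_n(\beta_n)}<\frac{A_n(2)}{A_n(\beta_n-1)}<\cdots<\frac{A_n(r-1)}{A_n(r+1)}<1$ (i.e. the ratios $\frac{A_n(k)}{A_n(\beta_n+1-k)}$, $k=1,\dots,r-1$, are strictly increasing, and the last one is $<1$), and $\frac{A_n(\beta_n)}{A_n(2)}<\frac{A_n(\beta_n-1)}{A_n(3)}<\cdots<\frac{A_n(r+1)}{A_n(r)}<1$ (i.e. the ratios $\frac{A_n(\beta_n+2-k)}{A_n(k)}$, $k=2,\dots,r$, are strictly increasing, and the last one is $<1$). 2. If $n\equiv 2 \pmod 4$, let $r=\frac{n(n-1)-2}{4}$. Then $\frac{A_n(1)}{A_n(\beta_n-1)}<\frac{A_n(2)}{A_n(\beta_n-2)}<\cdots<\frac{A_n(r)}{A_n(r+1)}<1$ (the ratios $\frac{A_n(k)}{A_n(\beta_n-k)}$, $k=1,\dots,r$), and $\frac{A_n(\beta_n-1)}{A_n(2)}<\frac{A_n(\beta_n-2)}{A_n(3)}<\cdots<\frac{A_n(r+2)}{A_n(r)}<1$ (the ratios $\frac{A_n(\beta_n+1-k)}{A_n(k)}$, $k=2,\dots,r$). 3. If $n\equiv 3 \pmod 4$, let $r=\frac{n(n-1)-2}{4}$.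 Then $\frac{A_n(1)}{A_n(\beta_n)}<\frac{A_n(2)}{A_n(\beta_n-1)}<\cdots<\frac{A_n(r)}{A_n(r+1)}<1$ (the ratios $\frac{A_n(k)}{A_n(\beta_n+1-k)}$, $k=1,\dots,r$), and $\frac{A_n(\beta_n)}{A_n(2)}<\frac{A_n(\beta_n-1)}{A_n(3)}<\cdots<\frac{A_n(r+2)}{A_n(r)}<1$ (the ratios $\frac{A_n(\beta_n+2-k)}{A_n(k)}$, $k=2,\dots,r$). 4. If $n\equiv 0 \pmod 4$, let $r=\frac{n(n-1)}{4}$. Then $\frac{A_n(1)}{A_n(\beta_n-1)}<\frac{A_n(2)}{A_n(\beta_n-2)}<\cdots<\frac{A_n(r-1)}{A_n(r+1)}<1$ (the ratios $\frac{A_n(k)}{A_n(\beta_n-k)}$, $k=1,\dots,r-1$), and $\frac{A_n(\beta_n-1)}{A_n(2)}<\frac{A_n(\beta_n-2)}{A_n(3)}<\cdots<\frac{A_n(r+1)}{A_n(r)}<1$ (the ratios $\frac{A_n(\beta_n+1-k)}{A_n(k)}$, $k=2,\dots,r$).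
   Context: $D_n$ is the set of derangements (fixed-point-free permutations) of $\{1,\dots,n\}$, and $\mathrm{maj}(\pi)=\sum_{i:\pi(i)>\pi(i+1)} i$ is the major index. The $q$-derangement number is $d_n(q)=\sum_{\pi\in D_n}q^{\mathrm{maj}(\pi)}$; equivalently $d_1(q)=0$ and $d_n(q)=(1+q+\cdots+q^{n-1})d_{n-1}(q)+(-1)^n q^{\binom n2}$ for $n\ge 2$. Its degree is $\beta_n=\binom n2$ if $n$ is even and $\beta_n=\binom n2-1$ if $n$ is odd, and $A_n(k)$ denotes the coefficient of $q^k$ in $d_n(q)$, $1\le k\le\beta_n$ (these are all positive). *)

theory Defs
  imports
    Complex_Main
    "HOL-Computational_Algebra.Polynomial"
    "HOL-Combinatorics.Permutations"
begin

definition derangements :: "nat \<Rightarrow> (nat \<Rightarrow> nat) set" where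
  "derangements n = {p. p permutes {1..n} \<and> (\<forall>i\<in>{1..n}. p i \<noteq> i)}"

definition major_index :: "nat \<Rightarrow> (nat \<Rightarrow> nat) \<Rightarrow> nat" where
  "major_index n p = \<Sum>{i \<in> {1..<n}. p i > p (i + 1)}"

definition q_derangement :: "nat \<Rightarrow> int poly" where
  "q_derangement n = (\<Sum>p\<in>derangements n. monom 1 (major_index n p))"

end

(* By Wachs' theorem, sum_k [n choose k]_q d_k(q) = [n]_q!; inverting gives
   d_n = [n]_q d_(n-1) + (-1)^n q^(n choose 2). The identity itself comes from replacing fixed points by
   zeros: the major index of all ways to insert n - k zeros into a signed word of length k has
   generating function q^maj [n choose k]_q, by induction on the last letter.

   Ratio monotonicity says that the coefficient sequence and its reflections about N/2 and (N+1)/2,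
   N = (n choose 2), are comparable in the likelihood ratio order. Multiplication by [n]_q is
   convolution with a window, which is totally positive of order two and hence preserves this order
   and commutes with reflection. The correction term at q^N does not interfere, except for the
   second chain when n is odd: there the top coefficient 1 of d_(n-1) produces a negative
   contribution, which is compensated by the minors next to the ends of the sequence, estimated
   through the explicit first three and last two coefficients of d_(n-2). *)
theory Submission
  imports Defs
begin

section \<open>Gaussian binomial coefficients and inversion\<close>

text \<open>Why strictness survives: the adjacent minor of two window sums is at least the adjacent
  minor of the old sequences at the same index. The old index range is shorter than the new one, but
  each cross product is symmetric under reflection, so only the lower half of the new range needs
  treatment. The correction at q^N is harmless because all four indices in a cross product lie
  between 1 and N - 1. For odd n the 1 on top of d_(n-1) is reflected to position 1, where it breaks
  the order at once. The comparison is therefore made for d_(n-1) without this 1, and its window sum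
  is added by hand. The critical place is the index n + 1: one of the two entries near the top has
  gained 1 and the other has not, so a whole window sum has to be beaten. The exact end coefficients
  matter because the estimate at position 3 has very little slack. The induction cannot start below
  6: d_5 has the equal coefficients 8 at q^5 and q^6, so its second chain ends in 1. Hence 6 and 7
  are both computed.\<close>

fun qbinom :: "'a::comm_ring_1 \<Rightarrow> nat \<Rightarrow> nat \<Rightarrow> 'a" where
  "qbinom q n 0 = 1"
| "qbinom q 0 (Suc k) = 0"
| "qbinom q (Suc n) (Suc k) = qbinom q n k + q ^ Suc k * qbinom q n (Suc k)"

definition qint :: "'a::comm_ring_1 \<Rightarrow> nat \<Rightarrow> 'a" where
  "qint q n = (\<Sum>i<n. q ^ i)"

definition qfact :: "'a::comm_ring_1 \<Rightarrow> nat \<Rightarrow> 'a" where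
  "qfact q n = (\<Prod>i=1..n. qint q i)"

lemma qint_add: "qint q (m + n) = qint q m + q ^ m * qint q n"
  by (induction n) (simp_all add: qint_def power_add algebra_simps)

lemma qfact_0 [simp]: "qfact q 0 = 1"
  by (simp add: qfact_def)

lemma qfact_Suc: "qfact q (Suc n) = qint q (Suc n) * qfact q n"
  by (simp add: qfact_def mult.commute)

lemma qbinom_eq_0 [simp]: "n < k \<Longrightarrow> qbinom q n k = 0"
  by (induction q n k rule: qbinom.induct) auto

lemma qbinom_self [simp]: "qbinom q n n = 1"
  by (induction n) auto

text \<open>The mirror image of the defining Pascal rule. Both rules are needed: the signs and
  descents of the signed word decide which one combines the two sums over insertions.\<close>

lemma qbinom_Suc_Suc':
  "k \<le> n \<Longrightarrow> qbinom q (Suc n) (Suc k) = q ^ (n - k) * qbinom q n k + qbinom q n (Suc k)"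
proof (induction n arbitrary: k)
  case 0
  then show ?case by simp
next
  case (Suc m)
  show ?case
  proof (cases k)
    case 0
    have "qbinom q (Suc (Suc m)) (Suc 0) = 1 + q * qbinom q (Suc m) (Suc 0)"
      by simp
    also have "\<dots> = 1 + q * (q ^ m + qbinom q m (Suc 0))"
      using Suc.IH[of 0] by simp
    also have "\<dots> = q ^ Suc m + qbinom q (Suc m) (Suc 0)"
      by (simp add: algebra_simps)
    finally show ?thesis
      using 0 by simp
  next
    case (Suc j)
    have j: "j \<le> m"
      using Suc.prems Suc by simp
    show ?thesis
    proof (cases "k = Suc m")
      case True
      then show ?thesis by simp
    next
      case False
      hence k: "k \<le> m"
        using Suc.prems by simp
      have "qbinom q (Suc (Suc m)) (Suc k)
          = qbinom q (Suc m) (Suc j) + q ^ Suc k * qbinom q (Suc m) (Suc k)"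
        using Suc by simp
      also have "\<dots> = q ^ (m - j) * qbinom q m j + qbinom q m k
          + (q ^ Suc k * q ^ (m - k) * qbinom q m k + q ^ Suc k * qbinom q m (Suc k))"
        unfolding Suc.IH[OF j] Suc.IH[OF k] by (simp add: Suc algebra_simps)
      also have "q ^ Suc k * q ^ (m - k) = q ^ (m - j) * q ^ k"
        using k Suc by (simp flip: power_add del: power_Suc)
      also have "q ^ (m - j) * qbinom q m j + qbinom q m k
          + (q ^ (m - j) * q ^ k * qbinom q m k + q ^ Suc k * qbinom q m (Suc k))
          = q ^ (Suc m - k) * qbinom q (Suc m) k + qbinom q (Suc m) (Suc k)"
        using k Suc by (simp add: algebra_simps)
      finally show ?thesis .
    qed
  qed
qed

lemma qbinom_mult_qfact: "k \<le> n \<Longrightarrow> qbinom q n k * qfact q k * qfact q (n - k) = qfact q n"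
proof (induction n arbitrary: k)
  case 0
  then show ?case by simp
next
  case (Suc n)
  show ?case
  proof (cases k)
    case 0
    then show ?thesis by simp
  next
    case (Suc j)
    have j: "j \<le> n"
      using Suc Suc.prems by simp
    show ?thesis
    proof (cases "j = n")
      case True
      then show ?thesis using Suc by simp
    next
      case False
      hence *: "Suc j \<le> n" "n - j = Suc (n - Suc j)"
        using j by auto
      have "qbinom q (Suc n) k * qfact q k * qfact q (Suc n - k)
         = qint q (Suc j) * (qbinom q n j * qfact q j * qfact q (n - j))
           + q ^ Suc j * qint q (n - j) * (qbinom q n (Suc j) * qfact q (Suc j) * qfact q (n - Suc j))"
        using Suc * by (simp add: qfact_Suc algebra_simps)
      also have "\<dots> = (qint q (Suc j) + q ^ Suc j * qint q (n - j)) * qfact q n"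
        unfolding Suc.IH[OF j] Suc.IH[OF *(1)] by (simp add: algebra_simps)
      also have "qint q (Suc j) + q ^ Suc j * qint q (n - j) = qint q (Suc n)"
        using qint_add[of q "Suc j" "n - j"] j by simp
      finally show ?thesis
        by (simp add: qfact_Suc)
    qed
  qed
qed

text \<open>Both sides agree after multiplication by q-factorials; cancelling these needs an
  integral domain with nonzero q-integers.\<close>

lemma qbinom_absorption:
  fixes q :: "'a::idom"
  assumes "\<And>n. n > 0 \<Longrightarrow> qint q n \<noteq> 0"
  shows "qint q (Suc k) * qbinom q (Suc n) (Suc k) = qint q (Suc n) * qbinom q n k"
proof (cases "k \<le> n")
  case True
  have nz: "qfact q m \<noteq> 0" for m
    using assms by (simp add: qfact_def)
  have "qint q (Suc k) * qbinom q (Suc n) (Suc k) * (qfact q k * qfact q (n - k)) = qfact q (Suc n)"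
    using qbinom_mult_qfact[of "Suc k" "Suc n" q] True
    by (simp add: qfact_Suc mult_ac del: qbinom.simps)
  also have "\<dots> = qint q (Suc n) * qbinom q n k * (qfact q k * qfact q (n - k))"
    using qbinom_mult_qfact[OF True, of q] by (simp add: qfact_Suc mult_ac)
  finally show ?thesis
    using nz by simp
qed simp

text \<open>By the Pascal rule every summand from index 1 on is a difference of consecutive values
  of \<open>(-1) ^ k * q ^ (k choose 2) * q ^ k * qbinom q n k\<close>, so the sum
  telescopes.\<close>

lemma qbinom_alternating_sum:
  "(\<Sum>k\<le>Suc n. (-1) ^ k * q ^ (k choose 2) * qbinom q (Suc n) k) = 0"
proof -
  have "(\<Sum>k\<le>Suc n. (-1) ^ k * q ^ (k choose 2) * qbinom q (Suc n) k)
      = 1 + (\<Sum>k\<le>n. (-1) ^ Suc k * q ^ (Suc k choose 2) * qbinom q (Suc n) (Suc k))"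
    by (simp only: sum.atMost_Suc_shift) (simp add: binomial_eq_0 numeral_2_eq_2)
  also have "(\<Sum>k\<le>n. (-1) ^ Suc k * q ^ (Suc k choose 2) * qbinom q (Suc n) (Suc k))
     = (\<Sum>k\<le>n. (-1) ^ Suc k * q ^ (Suc k choose 2) * q ^ (Suc k) * qbinom q n (Suc k)
           - (-1) ^ k * q ^ (k choose 2) * q ^ k * qbinom q n k)"
    by (intro sum.cong) (simp_all add: algebra_simps power_add numeral_2_eq_2)
  also have "\<dots> = - (\<Sum>k\<le>n. (-1) ^ k * q ^ (k choose 2) * q ^ k * qbinom q n k
           - (-1) ^ Suc k * q ^ (Suc k choose 2) * q ^ (Suc k) * qbinom q n (Suc k))"
    by (simp add: sum_subtractf del: power_Suc)
  also have "\<dots> = (-1) ^ Suc n * q ^ (Suc n choose 2) * q ^ Suc n * qbinom q n (Suc n)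
      - (-1) ^ 0 * q ^ (0 choose 2) * q ^ 0 * qbinom q n 0"
    by (subst sum_telescope[where f = "\<lambda>k. (-1) ^ k * q ^ (k choose 2) * q ^ k * qbinom q n k"]) simp
  also have "\<dots> = -1"
    by (simp add: binomial_eq_0 numeral_2_eq_2)
  finally show ?thesis by simp
qed

fun qder_rec :: "'a::comm_ring_1 \<Rightarrow> nat \<Rightarrow> 'a" where
  "qder_rec q 0 = 1"
| "qder_rec q (Suc n) = qint q (Suc n) * qder_rec q n + (-1) ^ Suc n * q ^ (Suc n choose 2)"

text \<open>Absorption moves the factor \<open>qint q (Suc k)\<close> of the recurrence out of the
  sum as \<open>qint q (Suc n)\<close>, leaving the induction hypothesis; the correction terms add
  up to the vanishing alternating sum.\<close>

lemma sum_qbinom_qder_rec: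
  fixes q :: "'a::idom"
  assumes "\<And>n. n > 0 \<Longrightarrow> qint q n \<noteq> 0"
  shows "(\<Sum>k\<le>n. qbinom q n k * qder_rec q k) = qfact q n"
proof (induction n)
  case 0
  then show ?case by simp
next
  case (Suc n)
  have "(\<Sum>k\<le>Suc n. qbinom q (Suc n) k * qder_rec q k)
      = 1 + (\<Sum>k\<le>n. qbinom q (Suc n) (Suc k) * qder_rec q (Suc k))"
    by (simp only: sum.atMost_Suc_shift) simp
  also have "(\<Sum>k\<le>n. qbinom q (Suc n) (Suc k) * qder_rec q (Suc k))
      = (\<Sum>k\<le>n. qint q (Suc k) * qbinom q (Suc n) (Suc k) * qder_rec q k)
        + (\<Sum>k\<le>n. (-1) ^ Suc k * q ^ (Suc k choose 2) * qbinom q (Suc n) (Suc k))"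
    by (simp add: sum.distrib[symmetric] algebra_simps del: qbinom.simps(3) power_Suc)
  also have "(\<Sum>k\<le>n. qint q (Suc k) * qbinom q (Suc n) (Suc k) * qder_rec q k) = qint q (Suc n) * qfact q n"
    by (simp add: qbinom_absorption[OF assms] Suc.IH[symmetric] sum_distrib_left mult_ac
             del: qbinom.simps(3))
  also have "1 + (qint q (Suc n) * qfact q n
        + (\<Sum>k\<le>n. (-1) ^ Suc k * q ^ (Suc k choose 2) * qbinom q (Suc n) (Suc k)))
      = qint q (Suc n) * qfact q n + (\<Sum>k\<le>Suc n. (-1) ^ k * q ^ (k choose 2) * qbinom q (Suc n) k)"
    by (simp only: sum.atMost_Suc_shift) (simp add: binomial_eq_0 numeral_2_eq_2)
  finally show ?case
    by (simp only: qbinom_alternating_sum qfact_Suc) simp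
qed

text \<open>The identities form a triangular system with diagonal entries
  \<open>qbinom q n n = 1\<close>.\<close>

lemma qder_rec_unique:
  fixes q :: "'a::idom"
  assumes "\<And>n. n > 0 \<Longrightarrow> qint q n \<noteq> 0"
    and "\<And>n. (\<Sum>k\<le>n. qbinom q n k * d k) = qfact q n"
  shows "d n = qder_rec q n"
proof (induction n rule: less_induct)
  case (less n)
  have "(\<Sum>k<n. qbinom q n k * d k) + d n = (\<Sum>k<n. qbinom q n k * qder_rec q k) + qder_rec q n"
    using assms(2)[of n] sum_qbinom_qder_rec[OF assms(1), of n]
    by (simp add: lessThan_Suc_atMost[symmetric])
  moreover have "(\<Sum>k<n. qbinom q n k * d k) = (\<Sum>k<n. qbinom q n k * qder_rec q k)"
    by (intro sum.cong) (auto simp: less)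
  ultimately show ?case by simp
qed

section \<open>Spreading a signed word\<close>

definition wmaj :: "nat \<Rightarrow> (nat \<Rightarrow> int) \<Rightarrow> nat" where
  "wmaj n w = \<Sum>{i \<in> {1..<n}. w i > w (i + 1)}"

text \<open>In the one-line notation of a permutation replace fixed points by 0 and make the values
  below the diagonal negative: this keeps the descents, and the fixed points become
  zeros inserted at the positions outside \<open>U\<close> into the signed word of a derangement.\<close>
definition spread :: "nat set \<Rightarrow> (nat \<Rightarrow> int) \<Rightarrow> nat \<Rightarrow> int" where
  "spread U v i = (if i \<in> U then v (card (U \<inter> {1..i})) else 0)"

lemma wmaj_0 [simp]: "wmaj 0 w = 0" and wmaj_1 [simp]: "wmaj (Suc 0) w = 0"
  by (simp_all add: wmaj_def)

lemma wmaj_Suc: "wmaj (Suc n) w = wmaj n w + (if w n > w (Suc n) then n else 0)"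
proof (cases "n = 0")
  case False
  have "{i \<in> {1..<Suc n}. w i > w (i + 1)} =
      {i \<in> {1..<n}. w i > w (i + 1)} \<union> (if w n > w (Suc n) then {n} else {})"
    using False by (auto simp: less_Suc_eq)
  then show ?thesis
    by (auto simp: wmaj_def)
qed simp

lemma wmaj_cong: "(\<And>i. 1 \<le> i \<Longrightarrow> i \<le> n \<Longrightarrow> v i = w i) \<Longrightarrow> wmaj n v = wmaj n w"
  unfolding wmaj_def by (rule sum.cong) auto

definition ksubsets :: "nat \<Rightarrow> nat \<Rightarrow> nat set set" where
  "ksubsets n k = {U. U \<subseteq> {1..n} \<and> card U = k}"

lemma finite_ksubsets [simp]: "finite (ksubsets n k)"
  unfolding ksubsets_def by (rule finite_subset[of _ "Pow {1..n}"]) auto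

lemma ksubsets_0: "ksubsets n 0 = {{}}"
  by (auto simp: ksubsets_def dest: finite_subset)

lemma ksubsets_0_left: "ksubsets 0 k = (if k = 0 then {{}} else {})"
  by (auto simp: ksubsets_def)

lemma ksubsets_notin: "{U \<in> ksubsets (Suc n) k. Suc n \<notin> U} = ksubsets n k"
  by (auto simp: ksubsets_def subset_eq le_Suc_eq)

lemma Suc_notin_ksubset: "U \<in> ksubsets n k \<Longrightarrow> Suc n \<notin> U"
  by (auto simp: ksubsets_def)

lemma ksubsets_in: "{U \<in> ksubsets (Suc n) (Suc k). Suc n \<in> U} = insert (Suc n) ` ksubsets n k"
proof (intro set_eqI iffI)
  fix U assume U: "U \<in> {U \<in> ksubsets (Suc n) (Suc k). Suc n \<in> U}"
  hence "finite U"
    by (auto simp: ksubsets_def dest: finite_subset)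
  hence "U - {Suc n} \<in> ksubsets n k"
    using U by (auto simp: ksubsets_def subset_eq le_Suc_eq)
  moreover have "U = insert (Suc n) (U - {Suc n})"
    using U by auto
  ultimately show "U \<in> insert (Suc n) ` ksubsets n k"
    by blast
next
  fix U assume "U \<in> insert (Suc n) ` ksubsets n k"
  then obtain V where V: "V \<in> ksubsets n k" "U = insert (Suc n) V"
    by auto
  hence "finite V" "Suc n \<notin> V"
    by (auto simp: ksubsets_def dest: finite_subset)
  then show "U \<in> {U \<in> ksubsets (Suc n) (Suc k). Suc n \<in> U}"
    using V by (auto simp: ksubsets_def)
qed

lemma spread_insert:
  "i \<le> n \<Longrightarrow> spread (insert (Suc n) U) v i = spread U v i"
  by (simp add: spread_def)

lemma spread_insert_self:
  assumes "U \<in> ksubsets n k"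
  shows "spread (insert (Suc n) U) v (Suc n) = v (Suc k)"
proof -
  have "insert (Suc n) U \<inter> {1..Suc n} = insert (Suc n) U" "finite U" "Suc n \<notin> U"
    using assms by (auto simp: ksubsets_def dest: finite_subset)
  then show ?thesis
    using assms by (simp add: spread_def ksubsets_def)
qed

lemma spread_top: "U \<in> ksubsets n k \<Longrightarrow> n \<in> U \<Longrightarrow> spread U v n = v k"
  by (auto simp: spread_def ksubsets_def Int_absorb2)

text \<open>The descent created by the next letter depends on whether the word now ends in
  \<open>v k\<close> or in an inserted zero; hence the split into \<open>sum_in\<close> and
  \<open>sum_out\<close>.\<close>

definition sum_in :: "'a::comm_ring_1 \<Rightarrow> (nat \<Rightarrow> int) \<Rightarrow> nat \<Rightarrow> nat \<Rightarrow> 'a" where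
  "sum_in q v n k = (\<Sum>U | U \<in> ksubsets n k \<and> n \<in> U. q ^ wmaj n (spread U v))"

definition sum_out :: "'a::comm_ring_1 \<Rightarrow> (nat \<Rightarrow> int) \<Rightarrow> nat \<Rightarrow> nat \<Rightarrow> 'a" where
  "sum_out q v n k = (\<Sum>U | U \<in> ksubsets n k \<and> n \<notin> U. q ^ wmaj n (spread U v))"

lemma sum_in_plus_sum_out:
  "sum_in q v n k + sum_out q v n k = (\<Sum>U\<in>ksubsets n k. q ^ wmaj n (spread U v))"
proof -
  have "(\<Sum>U\<in>ksubsets n k. q ^ wmaj n (spread U v))
    = (\<Sum>U\<in>{U \<in> ksubsets n k. n \<in> U} \<union> {U \<in> ksubsets n k. n \<notin> U}. q ^ wmaj n (spread U v))"
    by (rule sum.cong) auto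
  also have "\<dots> = sum_in q v n k + sum_out q v n k"
    unfolding sum_in_def sum_out_def by (rule sum.union_disjoint) auto
  finally show ?thesis ..
qed

lemma sum_out_Suc:
  "sum_out q v (Suc n) k = (if v k > 0 then q ^ n else 1) * sum_in q v n k + sum_out q v n k"
proof -
  have "sum_out q v (Suc n) k = (\<Sum>U\<in>ksubsets n k. q ^ wmaj (Suc n) (spread U v))"
    by (simp add: sum_out_def ksubsets_notin)
  also have "\<dots> = (\<Sum>U\<in>{U \<in> ksubsets n k. n \<in> U} \<union> {U \<in> ksubsets n k. n \<notin> U}. q ^ wmaj (Suc n) (spread U v))"
    by (rule sum.cong) auto
  also have "\<dots> = (\<Sum>U | U \<in> ksubsets n k \<and> n \<in> U. q ^ wmaj (Suc n) (spread U v))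
     + (\<Sum>U | U \<in> ksubsets n k \<and> n \<notin> U. q ^ wmaj (Suc n) (spread U v))"
    by (rule sum.union_disjoint) auto
  also have "(\<Sum>U | U \<in> ksubsets n k \<and> n \<in> U. q ^ wmaj (Suc n) (spread U v))
    = (if v k > 0 then q ^ n else 1) * sum_in q v n k"
    unfolding sum_in_def sum_distrib_left
  proof (rule sum.cong)
    fix U assume "U \<in> {U \<in> ksubsets n k. n \<in> U}"
    hence U: "U \<in> ksubsets n k" "n \<in> U" by auto
    have "spread U v (Suc n) = 0"
      using Suc_notin_ksubset[OF U(1)] by (simp add: spread_def)
    then show "q ^ wmaj (Suc n) (spread U v) = (if v k > 0 then q ^ n else 1) * q ^ wmaj n (spread U v)"
      by (simp add: wmaj_Suc spread_top[OF U] power_add)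
  qed auto
  also have "(\<Sum>U | U \<in> ksubsets n k \<and> n \<notin> U. q ^ wmaj (Suc n) (spread U v)) = sum_out q v n k"
    unfolding sum_out_def
  proof (rule sum.cong)
    fix U assume "U \<in> {U \<in> ksubsets n k. n \<notin> U}"
    hence U: "U \<in> ksubsets n k" "n \<notin> U" by auto
    have "spread U v (Suc n) = 0"
      using Suc_notin_ksubset[OF U(1)] by (simp add: spread_def)
    then show "q ^ wmaj (Suc n) (spread U v) = q ^ wmaj n (spread U v)"
      using U by (simp add: wmaj_Suc spread_def)
  qed auto
  finally show ?thesis .
qed

lemma sum_in_Suc:
  "sum_in q v (Suc n) (Suc k) =
     (if v k > v (Suc k) then q ^ n else 1) * sum_in q v n k
     + (if v (Suc k) < 0 then q ^ n else 1) * sum_out q v n k"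
proof -
  have "inj_on (insert (Suc n)) (ksubsets n k)"
    by (metis Suc_notin_ksubset inj_onI insert_ident)
  hence "sum_in q v (Suc n) (Suc k)
      = (\<Sum>U\<in>ksubsets n k. q ^ wmaj (Suc n) (spread (insert (Suc n) U) v))"
    by (simp add: sum_in_def ksubsets_in sum.reindex)
  also have "\<dots> = (\<Sum>U\<in>ksubsets n k. q ^ (wmaj n (spread U v) + (if spread U v n > v (Suc k) then n else 0)))"
  proof (rule sum.cong)
    fix U assume U: "U \<in> ksubsets n k"
    have "wmaj n (spread (insert (Suc n) U) v) = wmaj n (spread U v)"
      by (rule wmaj_cong) (auto simp: spread_insert)
    then show "q ^ wmaj (Suc n) (spread (insert (Suc n) U) v) =
        q ^ (wmaj n (spread U v) + (if spread U v n > v (Suc k) then n else 0))"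
      by (simp add: wmaj_Suc spread_insert spread_insert_self[OF U])
  qed auto
  also have "\<dots> = (\<Sum>U\<in>{U \<in> ksubsets n k. n \<in> U} \<union> {U \<in> ksubsets n k. n \<notin> U}.
      q ^ (wmaj n (spread U v) + (if spread U v n > v (Suc k) then n else 0)))"
    by (rule sum.cong) auto
  also have "\<dots> = (\<Sum>U | U \<in> ksubsets n k \<and> n \<in> U.
        q ^ (wmaj n (spread U v) + (if spread U v n > v (Suc k) then n else 0)))
     + (\<Sum>U | U \<in> ksubsets n k \<and> n \<notin> U.
        q ^ (wmaj n (spread U v) + (if spread U v n > v (Suc k) then n else 0)))"
    by (rule sum.union_disjoint) auto
  also have "(\<Sum>U | U \<in> ksubsets n k \<and> n \<in> U.
        q ^ (wmaj n (spread U v) + (if spread U v n > v (Suc k) then n else 0)))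
    = (if v k > v (Suc k) then q ^ n else 1) * sum_in q v n k"
    unfolding sum_in_def sum_distrib_left
    by (rule sum.cong) (auto simp: spread_top power_add)
  also have "(\<Sum>U | U \<in> ksubsets n k \<and> n \<notin> U.
        q ^ (wmaj n (spread U v) + (if spread U v n > v (Suc k) then n else 0)))
    = (if v (Suc k) < 0 then q ^ n else 1) * sum_out q v n k"
    unfolding sum_out_def sum_distrib_left
    by (rule sum.cong) (auto simp: spread_def power_add)
  finally show ?thesis .
qed

lemma sum_in_0 [simp]: "sum_in q v n 0 = 0"
proof -
  have "{U \<in> ksubsets n 0. n \<in> U} = {}"
    by (auto simp: ksubsets_0)
  then show ?thesis
    by (simp only: sum_in_def) simp
qed

lemma sum_out_0 [simp]: "sum_out q v n 0 = 1"
proof -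
  have "{U \<in> ksubsets n 0. n \<notin> U} = {{}}"
    by (auto simp: ksubsets_0)
  moreover have "wmaj n (spread {} v) = 0"
    by (simp add: wmaj_def spread_def)
  ultimately show ?thesis
    by (simp only: sum_out_def) simp
qed

lemma ksubsets_1: "k \<ge> 2 \<Longrightarrow> ksubsets (Suc 0) k = {}"
  by (auto simp: ksubsets_def dest: card_mono[rotated])

text \<open>Both formulas are proved in one induction, since each recursion step mixes the two sums.
  \<open>Suc n - k\<close> is the number of inserted zeros: a negative last letter behind a zero
  creates a descent, a positive one does not.\<close>

lemma sum_in_out_closed_form:
  assumes "\<forall>j\<in>{1..k}. v j \<noteq> 0"
  shows "sum_in q v (Suc n) k =
           (if k = 0 then 0
            else q ^ wmaj k v * (if v k < 0 then q ^ (Suc n - k) else 1) * qbinom q n (k - 1)) \<and>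
         sum_out q v (Suc n) k =
           q ^ wmaj k v * (if k > 0 \<and> v k > 0 then q ^ k else 1) * qbinom q n k"
  using assms
proof (induction n arbitrary: k)
  case 0
  consider "k = 0" | "k = 1" | "k \<ge> 2" by linarith
  then show ?case
  proof cases
    case 2
    have "ksubsets 1 1 = {{1}}"
      by (auto simp: ksubsets_def card_1_singleton_iff)
    hence "{U \<in> ksubsets (Suc 0) (Suc 0). Suc 0 \<in> U} = {{1}}" "{U \<in> ksubsets (Suc 0) (Suc 0). Suc 0 \<notin> U} = {}"
      by auto
    hence "sum_in q v (Suc 0) (Suc 0) = 1" "sum_out q v (Suc 0) (Suc 0) = 0"
      unfolding sum_in_def sum_out_def by (simp_all only:) simp_all
    then show ?thesis
      using 2 by simp
  next
    case 3
    then show ?thesis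
      by (cases k) (auto simp: sum_in_def sum_out_def ksubsets_1)
  qed simp
next
  case (Suc n)
  show ?case
  proof (cases k)
    case 0
    then show ?thesis by simp
  next
    case (Suc j)
    have nzk: "v k \<noteq> 0"
      using Suc.prems \<open>k = Suc j\<close> by auto
    have pre: "\<forall>i\<in>{1..j}. v i \<noteq> 0"
      using Suc.prems \<open>k = Suc j\<close> by auto
    note IHk = Suc.IH[OF Suc.prems] and IHj = Suc.IH[OF pre]
    have nzj: "v j \<noteq> 0" if "j > 0"
      using pre that by auto
    have out: "sum_out q v (Suc (Suc n)) k
        = q ^ wmaj k v * (if v k > 0 then q ^ k else 1) * qbinom q (Suc n) k"
    proof (cases "j \<le> n")
      case True
      define a b where "a = q ^ k" and "b = q ^ (n - j)"
      have ab: "q ^ Suc n = a * b"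
        unfolding a_def b_def using True Suc by (simp flip: power_add del: power_Suc)
      have P: "qbinom q (Suc n) k = qbinom q n j + a * qbinom q n k"
              "qbinom q (Suc n) k = b * qbinom q n j + qbinom q n k"
        using qbinom_Suc_Suc'[OF True, of q] Suc by (auto simp: a_def b_def)
      have b: "q ^ (Suc n - k) = b"
        by (simp add: b_def Suc)
      show ?thesis
      proof (cases "v k > 0")
        case True
        then show ?thesis
          using IHk Suc unfolding sum_out_Suc ab P(2) a_def[symmetric]
          by (auto simp: algebra_simps a_def[symmetric] simp del: power_Suc)
      next
        case False
        then show ?thesis
          using IHk nzk Suc unfolding sum_out_Suc P(2) b
          by (auto simp: algebra_simps simp del: power_Suc)
      qed
    next
      case False
      then show ?thesis
        using IHk Suc by (simp add: sum_out_Suc)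
    qed
    have inn: "sum_in q v (Suc (Suc n)) k
        = q ^ wmaj k v * (if v k < 0 then q ^ (Suc (Suc n) - k) else 1) * qbinom q (Suc n) j"
    proof (cases j)
      case 0
      then show ?thesis
        using IHj Suc by (simp add: sum_in_Suc wmaj_Suc)
    next
      case (Suc i)
      show ?thesis
      proof (cases "i \<le> n")
        case True
        define a b m where "a = q ^ j" and "b = q ^ (n - i)" and "m = q ^ wmaj j v"
        have ab: "q ^ Suc n = a * b"
          unfolding a_def b_def using True Suc by (simp flip: power_add del: power_Suc)
        have P: "qbinom q (Suc n) j = qbinom q n i + a * qbinom q n j"
                "qbinom q (Suc n) j = b * qbinom q n i + qbinom q n j"
          using qbinom_Suc_Suc'[OF True, of q] Suc by (auto simp: a_def b_def)
        have b: "q ^ (Suc n - j) = b" "q ^ (Suc (Suc n) - k) = b"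
          by (simp_all add: b_def Suc \<open>k = Suc j\<close>)
        have X: "sum_in q v (Suc n) j = m * (if v j < 0 then b else 1) * qbinom q n i"
          and Y: "sum_out q v (Suc n) j = m * (if v j > 0 then a else 1) * qbinom q n j"
          using IHj Suc unfolding b a_def[symmetric] m_def by simp_all
        have mk: "q ^ wmaj k v = m * (if v j > v k then a else 1)"
          by (simp add: \<open>k = Suc j\<close> wmaj_Suc power_add m_def a_def)
        have step: "sum_in q v (Suc (Suc n)) k = (if v j > v k then a * b else 1) * sum_in q v (Suc n) j
            + (if v k < 0 then a * b else 1) * sum_out q v (Suc n) j"
          unfolding \<open>k = Suc j\<close> sum_in_Suc ab ..
        have "v j \<noteq> 0"
          using nzj Suc by simp
        \<comment> \<open>In each pattern of signs and descent the powers of \<open>q\<close>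
          combine so that exactly one of the two Pascal rules in \<open>P\<close> closes the
          case.\<close>
        then consider "v j > 0" "v k > 0" "v j > v k" | "v j > 0" "v k > 0" "\<not> v j > v k"
          | "v j > 0" "v k < 0" | "v j < 0" "v k > 0"
          | "v j < 0" "v k < 0" "v j > v k" | "v j < 0" "v k < 0" "\<not> v j > v k"
          using nzk by linarith
        then show ?thesis
        proof cases
          case 1 then show ?thesis by (simp add: step X Y mk b P(2) algebra_simps)
        next
          case 2 then show ?thesis by (simp add: step X Y mk b P(1) algebra_simps)
        next
          case 3 then show ?thesis by (simp add: step X Y mk b P(1) algebra_simps)
        next
          case 4 then show ?thesis by (simp add: step X Y mk b P(2) algebra_simps)
        next
          case 5 then show ?thesis by (simp add: step X Y mk b P(2) algebra_simps)
        next
          case 6 then show ?thesis by (simp add: step X Y mk b P(1) algebra_simps)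
        qed
      next
        case False
        then show ?thesis
          using IHj Suc \<open>k = Suc j\<close> by (simp add: sum_in_Suc)
      qed
    qed
    show ?thesis
      using inn out Suc by simp
  qed
qed

text \<open>The sign of \<open>v k\<close> decides which Pascal rule adds the two closed forms, but
  the total is the same, so \<open>v\<close> enters only through its major index.\<close>

lemma sum_power_wmaj_spread:
  assumes "\<forall>j\<in>{1..k}. v j \<noteq> 0"
  shows "(\<Sum>U\<in>ksubsets n k. q ^ wmaj n (spread U v)) = q ^ wmaj k v * qbinom q n k"
proof (cases n)
  case 0
  then show ?thesis
    by (cases k) (simp_all add: ksubsets_0_left)
next
  case (Suc m)
  show ?thesis
  proof (cases k)
    case 0
    then show ?thesis
      by (simp add: sum_in_plus_sum_out[symmetric])
  next
    case (Suc j)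
    have "v k \<noteq> 0"
      using assms Suc by auto
    note cf = sum_in_out_closed_form[OF assms, of q m]
    show ?thesis
    proof (cases "j \<le> m")
      case True
      show ?thesis
      proof (cases "v k > 0")
        case True
        then show ?thesis
          using cf Suc \<open>n = Suc m\<close> by (simp add: sum_in_plus_sum_out[symmetric] algebra_simps)
      next
        case False
        then show ?thesis
          using cf Suc \<open>n = Suc m\<close> \<open>v k \<noteq> 0\<close> qbinom_Suc_Suc'[OF True, of q]
          by (simp add: sum_in_plus_sum_out[symmetric] algebra_simps del: qbinom.simps(3))
      qed
    next
      case False
      then show ?thesis
        using cf Suc \<open>n = Suc m\<close> by (simp add: sum_in_plus_sum_out[symmetric])
    qed
  qed
qed

section \<open>The recurrence for the q-derangement numbers\<close>

lemma wmaj_of_nat: "wmaj n (\<lambda>i. int (p i)) = major_index n p"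
  by (simp add: wmaj_def major_index_def)

section \<open>MacMahon's theorem on the major index of permutations\<close>

lemma major_index_Suc:
  "major_index (Suc n) p = major_index n p + (if p n > p (Suc n) then n else 0)"
  by (simp add: wmaj_of_nat[symmetric] wmaj_Suc)

lemma major_index_strict_mono_comp:
  assumes "p permutes {1..n}" "strict_mono_on {1..n} f"
  shows "major_index n (\<lambda>i. f (p i)) = major_index n p"
proof -
  have "f (p (Suc i)) < f (p i) \<longleftrightarrow> p (Suc i) < p i" if "i \<in> {1..<n}" for i
  proof -
    have "p i \<in> {1..n}" "p (Suc i) \<in> {1..n}"
      using that permutes_in_image[OF assms(1)] by auto
    then show ?thesis
      using assms(2) by (meson strict_mono_on_less)
  qed
  then show ?thesis
    unfolding major_index_def by (intro sum.cong) auto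
qed

text \<open>The cycle (j, j+1, ..., N). It increases on the values below \<open>N\<close> and skips
  \<open>j\<close>, so composing with a permutation that fixes \<open>N\<close> prescribes the last
  entry and keeps the relative order of the others.\<close>

definition last_to :: "nat \<Rightarrow> nat \<Rightarrow> nat \<Rightarrow> nat" where
  "last_to N j x = (if x = N then j else if j \<le> x \<and> x < N then Suc x else x)"

lemma last_to_permutes:
  assumes j: "j \<in> {1..N}"
  shows "last_to N j permutes {1..N}"
proof (rule inj_imp_permutes)
  show "inj_on (last_to N j) {1..N}"
    using j by (auto simp: inj_on_def last_to_def split: if_splits)
qed (use j in \<open>auto simp: last_to_def\<close>)

lemma bij_betw_permutations_last:
  assumes "j \<in> {1..Suc n}"
  shows "bij_betw (\<lambda>p. last_to (Suc n) j \<circ> p) {p. p permutes {1..n}}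
           {p. p permutes {1..Suc n} \<and> p (Suc n) = j}"
proof -
  let ?c = "last_to (Suc n) j"
  have c: "?c permutes {1..Suc n}"
    by (rule last_to_permutes[OF assms])
  show ?thesis
  proof (rule bij_betwI[where g = "\<lambda>p. inv ?c \<circ> p"])
    show "(\<lambda>p. ?c \<circ> p) \<in> {p. p permutes {1..n}} \<rightarrow> {p. p permutes {1..Suc n} \<and> p (Suc n) = j}"
    proof safe
      fix p assume p: "p permutes {1..n}"
      hence "p permutes {1..Suc n}"
        by (rule permutes_subset) auto
      then show "?c \<circ> p permutes {1..Suc n}"
        using c by (rule permutes_compose)
      show "(?c \<circ> p) (Suc n) = j"
        using permutes_not_in[OF p, of "Suc n"] by (simp add: last_to_def)
    qed
    show "(\<lambda>p. inv ?c \<circ> p) \<in> {p. p permutes {1..Suc n} \<and> p (Suc n) = j} \<rightarrow> {p. p permutes {1..n}}"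
    proof safe
      fix p assume p: "p permutes {1..Suc n}" and j: "j = p (Suc n)"
      have "?c (Suc n) = p (Suc n)"
        using j by (simp add: last_to_def)
      hence "inv ?c (p (Suc n)) = Suc n"
        by (metis c permutes_inverses(2))
      moreover have "inv ?c \<circ> p permutes {1..Suc n}"
        using p permutes_inv[OF c] by (rule permutes_compose)
      ultimately have "inv ?c \<circ> p permutes {1..n}"
        by (elim permutes_superset) (auto simp: le_Suc_eq)
      then show "inv (last_to (Suc n) (p (Suc n))) \<circ> p permutes {1..n}"
        using j by simp
    qed
  qed (simp_all add: o_assoc permutes_inv_o[OF c])
qed

text \<open>The exponents \<open>m - i\<close> run through 0, ..., \<open>m - 1\<close>; raising the
  smallest \<open>Suc m - j\<close> of them by \<open>m\<close> yields again \<open>m\<close>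
  consecutive exponents, now starting at \<open>Suc m - j\<close>.\<close>

lemma geometric_sum_split:
  fixes q :: "'a::comm_ring_1"
  assumes "j \<in> {1..Suc m}"
  shows "(\<Sum>i=1..m. (if i \<ge> j then q ^ m else 1) * q ^ (m - i)) = q ^ (Suc m - j) * qint q m"
proof -
  have "(\<Sum>i=1..m. (if i \<ge> j then q ^ m else 1) * q ^ (m - i))
      = (\<Sum>t<m. (if t < Suc m - j then q ^ m else 1) * q ^ t)"
    by (rule sum.reindex_bij_witness[where i = "\<lambda>t. m - t" and j = "\<lambda>i. m - i"])
       (use assms in auto)
  also have "\<dots> = (\<Sum>t\<in>{..<Suc m - j} \<union> {Suc m - j..<m}. (if t < Suc m - j then q ^ m else 1) * q ^ t)"
    by (rule sum.cong) (use assms in auto)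
  also have "\<dots> = (\<Sum>t<Suc m - j. q ^ m * q ^ t) + (\<Sum>t=Suc m - j..<m. q ^ t)"
    by (subst sum.union_disjoint) auto
  also have "(\<Sum>t<Suc m - j. q ^ m * q ^ t) = (\<Sum>t=m..<m + (Suc m - j). q ^ t)"
    by (rule sum.reindex_bij_witness[where i = "\<lambda>t. t - m" and j = "\<lambda>t. m + t"])
       (auto simp: power_add)
  also have "(\<Sum>t=m..<m + (Suc m - j). q ^ t) + (\<Sum>t=Suc m - j..<m. q ^ t)
      = (\<Sum>t=Suc m - j..<m + (Suc m - j). q ^ t)"
    by (subst add.commute) (rule sum.atLeastLessThan_concat, use assms in auto)
  also have "\<dots> = (\<Sum>t<m. q ^ (Suc m - j) * q ^ t)"
    by (rule sum.reindex_bij_witness[where i = "\<lambda>t. Suc m - j + t" and j = "\<lambda>t. t - (Suc m - j)"])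
       (auto simp: power_add[symmetric])
  also have "\<dots> = q ^ (Suc m - j) * qint q m"
    by (simp add: qint_def sum_distrib_left)
  finally show ?thesis .
qed

text \<open>MacMahon's theorem refined by the last entry, which makes it inductive: removing this
  entry leaves a permutation whose last entry \<open>i\<close> satisfies \<open>i \<ge> j\<close>
  exactly when a descent is lost.\<close>

lemma sum_power_major_index_last:
  fixes q :: "'a::comm_ring_1"
  assumes "j \<in> {1..Suc n}"
  shows "(\<Sum>p | p permutes {1..Suc n} \<and> p (Suc n) = j. q ^ major_index (Suc n) p)
      = q ^ (Suc n - j) * qfact q n"
  using assms
proof (induction n arbitrary: j)
  case 0
  have "{p. p permutes {Suc 0} \<and> p (Suc 0) = Suc 0} = {id}"
    by (auto simp: permutes_sing)
  then show ?case
    using 0 by (simp add: major_index_def)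
next
  case (Suc n)
  let ?c = "last_to (Suc (Suc n)) j"
  have mono: "strict_mono_on {1..Suc n} ?c"
    by (auto simp: strict_mono_on_def last_to_def)
  have maj: "major_index (Suc (Suc n)) (?c \<circ> p)
      = major_index (Suc n) p + (if p (Suc n) \<ge> j then Suc n else 0)" if p: "p permutes {1..Suc n}" for p
  proof -
    have "p (Suc n) \<in> {1..Suc n}" "p (Suc (Suc n)) = Suc (Suc n)"
      using permutes_in_image[OF p] permutes_not_in[OF p] by auto
    then show ?thesis
      using major_index_strict_mono_comp[OF p mono]
      by (auto simp: major_index_Suc[of "Suc n"] o_def last_to_def)
  qed
  have "(\<Sum>p | p permutes {1..Suc (Suc n)} \<and> p (Suc (Suc n)) = j. q ^ major_index (Suc (Suc n)) p)
      = (\<Sum>p | p permutes {1..Suc n}. q ^ major_index (Suc (Suc n)) (?c \<circ> p))"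
    using sum.reindex_bij_betw[OF bij_betw_permutations_last[OF Suc.prems],
        of "\<lambda>p. q ^ major_index (Suc (Suc n)) p"] by simp
  also have "\<dots> = (\<Sum>p\<in>{p. p permutes {1..Suc n}}.
      q ^ major_index (Suc n) p * (if p (Suc n) \<ge> j then q ^ Suc n else 1))"
    by (intro sum.cong) (auto simp: maj power_add simp del: power_Suc)
  also have "\<dots> = (\<Sum>i\<in>{1..Suc n}. \<Sum>p | p \<in> {p. p permutes {1..Suc n}} \<and> p (Suc n) = i.
      q ^ major_index (Suc n) p * (if p (Suc n) \<ge> j then q ^ Suc n else 1))"
  proof (rule sum.group[symmetric])
    show "(\<lambda>p. p (Suc n)) ` {p. p permutes {1..Suc n}} \<subseteq> {1..Suc n}"
    proof safe
      fix p assume "p permutes {1..Suc n}"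
      then show "p (Suc n) \<in> {1..Suc n}"
        using permutes_in_image[of p "{1..Suc n}" "Suc n"] by simp
    qed
  qed (simp_all add: finite_permutations)
  also have "\<dots> = (\<Sum>i\<in>{1..Suc n}. (if i \<ge> j then q ^ Suc n else 1) *
      (\<Sum>p | p permutes {1..Suc n} \<and> p (Suc n) = i. q ^ major_index (Suc n) p))"
    unfolding sum_distrib_left by (intro sum.cong refl) (auto simp: mult_ac)
  also have "\<dots> = (\<Sum>i\<in>{1..Suc n}. (if i \<ge> j then q ^ Suc n else 1) * q ^ (Suc n - i)) * qfact q n"
    unfolding sum_distrib_right by (intro sum.cong refl) (simp only: Suc.IH mult.assoc)
  also have "\<dots> = q ^ (Suc (Suc n) - j) * qfact q (Suc n)"
    by (simp only: geometric_sum_split[OF Suc.prems] qfact_Suc mult.assoc)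
  finally show ?case .
qed

theorem sum_power_major_index:
  fixes q :: "'a::comm_ring_1"
  shows "(\<Sum>p | p permutes {1..n}. q ^ major_index n p) = qfact q n"
proof -
  have "bij_betw (\<lambda>p. p) {p. p permutes {1..n}} {p. p permutes {1..Suc n} \<and> p (Suc n) = Suc n}"
  proof -
    have "last_to (Suc n) (Suc n) = id"
      by (auto simp: last_to_def)
    then show ?thesis
      using bij_betw_permutations_last[of "Suc n" n] by simp
  qed
  hence "(\<Sum>p | p permutes {1..n}. q ^ major_index (Suc n) p)
      = (\<Sum>p | p permutes {1..Suc n} \<and> p (Suc n) = Suc n. q ^ major_index (Suc n) p)"
    by (rule sum.reindex_bij_betw)
  moreover have "major_index (Suc n) p = major_index n p" if p: "p permutes {1..n}" for p
  proof (cases "n = 0")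
    case False
    then show ?thesis
      using permutes_in_image[OF p, of n] permutes_not_in[OF p, of "Suc n"]
      by (auto simp: major_index_Suc)
  qed (simp add: major_index_def)
  ultimately show ?thesis
    using sum_power_major_index_last[of "Suc n" n q] by simp
qed

text \<open>The shift by \<open>k + 1\<close> makes the entries below the diagonal negative without changing
  their relative order.\<close>
definition signed_word :: "nat \<Rightarrow> (nat \<Rightarrow> nat) \<Rightarrow> nat \<Rightarrow> int" where
  "signed_word k p j = (if p j > j then int (p j) else int (p j) - int k - 1)"

section \<open>Reducing a permutation to a derangement of its moved points\<close>

definition rank :: "nat set \<Rightarrow> nat \<Rightarrow> nat" where
  "rank U i = card (U \<inter> {1..i})"

lemma rank_less_iff:
  assumes "finite U" "i \<in> U" "j \<in> U" "i \<ge> 1" "j \<ge> 1"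
  shows "rank U i < rank U j \<longleftrightarrow> i < j"
proof -
  have *: "rank U i < rank U j" if "i < j" "j \<in> U" "j \<ge> 1" for i j
  proof -
    have "U \<inter> {1..i} \<subseteq> U \<inter> {1..j}" "j \<in> U \<inter> {1..j}" "j \<notin> U \<inter> {1..i}"
      using that by auto
    then show ?thesis
      unfolding rank_def using assms(1) by (intro psubset_card_mono) auto
  qed
  show ?thesis
    using *[of i j] *[of j i] assms by (cases i j rule: linorder_cases) auto
qed

lemma bij_betw_rank:
  assumes "U \<subseteq> {1..n}"
  shows "bij_betw (rank U) U {1..card U}"
proof -
  have fin: "finite U"
    using assms finite_subset by auto
  have inj: "inj_on (rank U) U"
  proof (rule inj_onI)
    fix i j assume "i \<in> U" "j \<in> U" "rank U i = rank U j"
    then show "i = j"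
      using rank_less_iff[OF fin, of i j] rank_less_iff[OF fin, of j i] assms
      by (cases i j rule: linorder_cases) (auto simp: subset_eq)
  qed
  moreover have "rank U ` U \<subseteq> {1..card U}"
  proof safe
    fix i assume "i \<in> U"
    hence "i \<in> U \<inter> {1..i}"
      using assms by auto
    hence "rank U i \<noteq> 0"
      using fin by (auto simp: rank_def)
    moreover have "rank U i \<le> card U"
      unfolding rank_def using fin by (intro card_mono) auto
    ultimately show "rank U i \<in> {1..card U}" by simp
  qed
  ultimately show ?thesis
    by (simp add: bij_betw_def card_image card_subset_eq)
qed

definition nonfixing :: "nat set \<Rightarrow> (nat \<Rightarrow> nat) set" where
  "nonfixing U = {p. p permutes U \<and> (\<forall>i\<in>U. p i \<noteq> i)}"

text \<open>Conjugation by \<open>rank U\<close>, written in the shape that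
  \<open>bij_betw_permutations\<close> produces.\<close>

definition reduce :: "nat set \<Rightarrow> (nat \<Rightarrow> nat) \<Rightarrow> nat \<Rightarrow> nat" where
  "reduce U p j = (if j \<in> {1..card U} then rank U (p (inv_into U (rank U) j)) else j)"

lemma reduce_rank:
  assumes "U \<subseteq> {1..n}" "i \<in> U"
  shows "reduce U p (rank U i) = rank U (p i)"
  using bij_betw_rank[OF assms(1)] assms(2)
  by (auto simp: reduce_def bij_betw_def inv_into_f_f)

lemma bij_betw_reduce:
  assumes "U \<subseteq> {1..n}"
  shows "bij_betw (reduce U) (nonfixing U) (derangements (card U))"
proof -
  note b = bij_betw_rank[OF assms]
  have *: "bij_betw (reduce U) {p. p permutes U} {p. p permutes {1..card U}}"
    using bij_betw_permutations[OF b] by (simp add: reduce_def[abs_def])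
  have **: "(\<forall>i\<in>U. p i \<noteq> i) \<longleftrightarrow> (\<forall>j\<in>{1..card U}. reduce U p j \<noteq> j)" if p: "p permutes U" for p
  proof -
    have "{1..card U} = rank U ` U"
      using b by (simp add: bij_betw_def)
    hence "(\<forall>j\<in>{1..card U}. reduce U p j \<noteq> j) \<longleftrightarrow> (\<forall>i\<in>U. reduce U p (rank U i) \<noteq> rank U i)"
      by (simp only: ball_simps)
    also have "\<dots> \<longleftrightarrow> (\<forall>i\<in>U. p i \<noteq> i)"
      using b permutes_in_image[OF p] reduce_rank[OF assms, of _ p]
      by (auto simp: bij_betw_def inj_on_eq_iff)
    finally show ?thesis ..
  qed
  have "bij_betw (reduce U) {p \<in> {p. p permutes U}. \<forall>i\<in>U. p i \<noteq> i}
      {p \<in> {p. p permutes {1..card U}}. \<forall>i\<in>{1..card U}. p i \<noteq> i}"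
    by (rule bij_betw_Collect[OF *]) (simp only: ** mem_Collect_eq)
  then show ?thesis
    by (simp add: nonfixing_def derangements_def)
qed

lemma signed_word_nonzero:
  "p \<in> derangements k \<Longrightarrow> \<forall>j\<in>{1..k}. signed_word k p j \<noteq> 0"
proof
  fix j assume "p \<in> derangements k" "j \<in> {1..k}"
  hence "p j \<in> {1..k}"
    using permutes_in_image[of p "{1..k}" j] by (simp add: derangements_def)
  then show "signed_word k p j \<noteq> 0"
    by (auto simp: signed_word_def)
qed

text \<open>An entry above the diagonal followed by one below it is always a descent, the opposite
  order always an ascent; two entries of the same kind are shifted equally.\<close>

lemma wmaj_signed_word:
  assumes "p \<in> derangements k"
  shows "wmaj k (signed_word k p) = major_index k p"
proof -
  have "signed_word k p (Suc i) < signed_word k p i \<longleftrightarrow> p (Suc i) < p i" if i: "i \<in> {1..<k}" for i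
  proof -
    have "p i \<in> {1..k}" "p (Suc i) \<in> {1..k}" "p i \<noteq> i" "p (Suc i) \<noteq> Suc i"
      using assms i permutes_in_image[of p "{1..k}"] by (auto simp: derangements_def)
    then show ?thesis
      by (auto simp: signed_word_def)
  qed
  then show ?thesis
    unfolding wmaj_def major_index_def by (intro sum.cong) auto
qed

lemma major_index_nonfixing:
  assumes U: "U \<subseteq> {1..n}" and p: "p \<in> nonfixing U"
  shows "major_index n p = wmaj n (spread U (signed_word (card U) (reduce U p)))"
proof -
  let ?s = "spread U (signed_word (card U) (reduce U p))"
  have fin: "finite U"
    using U finite_subset by auto
  have per: "p permutes U" and nf: "\<And>i. i \<in> U \<Longrightarrow> p i \<noteq> i"
    using p by (auto simp: nonfixing_def)
  have ge1: "i \<ge> 1" if "i \<in> U" for i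
    using U that by auto
  have pin: "p i \<in> U" if "i \<in> U" for i
    using permutes_in_image[OF per] that by auto
  have less: "rank U i < rank U j \<longleftrightarrow> i < j" if "i \<in> U" "j \<in> U" for i j
    using rank_less_iff[OF fin] that ge1 by auto
  have bound: "1 \<le> rank U i" "rank U i \<le> card U" if "i \<in> U" for i
    using bij_betw_rank[OF U] that by (auto simp: bij_betw_def)
  have s_in: "?s i = (if p i > i then int (rank U (p i)) else int (rank U (p i)) - int (card U) - 1)"
    if "i \<in> U" for i
  proof -
    have "?s i = signed_word (card U) (reduce U p) (rank U i)"
      using that by (simp add: spread_def rank_def)
    then show ?thesis
      using that pin[OF that] reduce_rank[OF U that, of p] less by (simp add: signed_word_def)
  qed
  have s_out: "?s i = 0" "p i = i" if "i \<notin> U" for i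
    using that permutes_not_in[OF per] by (auto simp: spread_def)
  have "?s (Suc i) < ?s i \<longleftrightarrow> p (Suc i) < p i" for i
  proof -
    consider "i \<in> U" "Suc i \<in> U" | "i \<in> U" "Suc i \<notin> U" | "i \<notin> U" "Suc i \<in> U" | "i \<notin> U" "Suc i \<notin> U"
      by blast
    then show ?thesis
    proof cases
      case 1
      then show ?thesis
        using less[OF pin[OF 1(2)] pin[OF 1(1)]] bound[OF pin[OF 1(1)]] bound[OF pin[OF 1(2)]]
          nf[OF 1(1)] nf[OF 1(2)] by (auto simp: s_in)
    next
      case 2
      \<comment> \<open>\<open>Suc i\<close> is a fixed point, so its value is taken; thus
        \<open>p i > Suc i\<close> is the same as \<open>p i > i\<close>, which is what the sign of
        the letter records.\<close>
      hence "p i \<noteq> Suc i"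
        using pin by metis
      then show ?thesis
        using 2 bound[OF pin[OF 2(1)]] nf[OF 2(1)] by (auto simp: s_in s_out)
    next
      case 3
      \<comment> \<open>Likewise \<open>p (Suc i) < i\<close> is the same as
        \<open>p (Suc i) < Suc i\<close>, a negative letter after a zero.\<close>
      hence "p (Suc i) \<noteq> i"
        using pin by metis
      then show ?thesis
        using 3 bound[OF pin[OF 3(2)]] nf[OF 3(2)] by (auto simp: s_in s_out)
    qed (auto simp: s_out)
  qed
  then show ?thesis
    unfolding wmaj_def major_index_def by simp
qed

lemma finite_derangements [simp]: "finite (derangements n)"
  unfolding derangements_def by (rule finite_subset[OF _ finite_permutations[of "{1..n}"]]) auto

text \<open>Permutations are grouped by their set \<open>U\<close> of moved points and reduced to
  derangements of \<open>card U\<close> points. For a fixed derangement, letting \<open>U\<close>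
  vary is inserting zeros in all ways, which yields the Gaussian binomial.\<close>

lemma sum_qbinom_derangements:
  fixes q :: "'a::comm_ring_1"
  shows "(\<Sum>k\<le>n. qbinom q n k * (\<Sum>p\<in>derangements k. q ^ major_index k p)) = qfact q n"
proof -
  have "qfact q n = (\<Sum>p\<in>{p. p permutes {1..n}}. q ^ major_index n p)"
    by (rule sum_power_major_index[symmetric])
  also have "\<dots> = (\<Sum>U\<in>Pow {1..n}. \<Sum>p | p \<in> {p. p permutes {1..n}} \<and> {i. p i \<noteq> i} = U. q ^ major_index n p)"
    by (rule sum.group[symmetric]) (use permutes_not_in in \<open>force simp: finite_permutations\<close>)+
  also have "\<dots> = (\<Sum>U\<in>Pow {1..n}. \<Sum>p\<in>nonfixing U. q ^ major_index n p)"
  proof (intro sum.cong refl)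
    fix U assume U: "U \<in> Pow {1..n}"
    have "p permutes {1..n} \<and> {i. p i \<noteq> i} = U \<longleftrightarrow> p \<in> nonfixing U" for p
    proof
      assume p: "p permutes {1..n} \<and> {i. p i \<noteq> i} = U"
      hence "p permutes U"
        by (blast intro: permutes_superset)
      then show "p \<in> nonfixing U"
        using p by (auto simp: nonfixing_def)
    next
      assume "p \<in> nonfixing U"
      then show "p permutes {1..n} \<and> {i. p i \<noteq> i} = U"
        using U permutes_not_in[of p U] by (auto simp: nonfixing_def intro: permutes_subset)
    qed
    then show "{p \<in> {p. p permutes {1..n}}. {i. p i \<noteq> i} = U} = nonfixing U"
      by auto
  qed
  also have "\<dots> = (\<Sum>U\<in>Pow {1..n}. \<Sum>p\<in>derangements (card U).
      q ^ wmaj n (spread U (signed_word (card U) p)))"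
  proof (rule sum.cong[OF refl])
    fix U assume U: "U \<in> Pow {1..n}"
    have "(\<Sum>p\<in>nonfixing U. q ^ major_index n p)
        = (\<Sum>p\<in>nonfixing U. q ^ wmaj n (spread U (signed_word (card U) (reduce U p))))"
      using U by (intro sum.cong) (auto simp: major_index_nonfixing)
    also have "\<dots> = (\<Sum>p\<in>derangements (card U). q ^ wmaj n (spread U (signed_word (card U) p)))"
      using U by (intro sum.reindex_bij_betw bij_betw_reduce) auto
    finally show "(\<Sum>p\<in>nonfixing U. q ^ major_index n p)
        = (\<Sum>p\<in>derangements (card U). q ^ wmaj n (spread U (signed_word (card U) p)))" .
  qed
  also have "\<dots> = (\<Sum>k\<in>{..n}. \<Sum>U | U \<in> Pow {1..n} \<and> card U = k. \<Sum>p\<in>derangements (card U).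
      q ^ wmaj n (spread U (signed_word (card U) p)))"
    by (rule sum.group[symmetric]) (auto dest: card_mono[rotated])
  also have "\<dots> = (\<Sum>k\<in>{..n}. \<Sum>U\<in>ksubsets n k. \<Sum>p\<in>derangements k.
      q ^ wmaj n (spread U (signed_word k p)))"
    by (intro sum.cong) (auto simp: ksubsets_def)
  also have "\<dots> = (\<Sum>k\<in>{..n}. \<Sum>p\<in>derangements k. \<Sum>U\<in>ksubsets n k.
      q ^ wmaj n (spread U (signed_word k p)))"
    by (intro sum.cong refl sum.swap)
  also have "\<dots> = (\<Sum>k\<in>{..n}. \<Sum>p\<in>derangements k. q ^ major_index k p * qbinom q n k)"
    by (intro sum.cong refl)
       (simp add: sum_power_wmaj_spread[OF signed_word_nonzero] wmaj_signed_word)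
  also have "\<dots> = (\<Sum>k\<le>n. qbinom q n k * (\<Sum>p\<in>derangements k. q ^ major_index k p))"
    by (simp add: sum_distrib_left mult.commute)
  finally show ?thesis ..
qed

lemma q_derangement_eq_qder_rec: "q_derangement n = qder_rec (monom 1 1) n"
proof (rule qder_rec_unique)
  fix n :: nat assume "n > 0"
  \<comment> \<open>Evaluation at 1 shows that the q-integers are nonzero polynomials.\<close>
  have "poly (qint (monom 1 1) n) (1::int) = int n"
    by (simp add: qint_def poly_sum poly_monom poly_power)
  then show "qint (monom (1::int) 1) n \<noteq> 0"
    using \<open>n > 0\<close> by auto
next
  fix n
  have "q_derangement k = (\<Sum>p\<in>derangements k. monom 1 1 ^ major_index k p)" for k
    by (simp add: q_derangement_def monom_power)
  then show "(\<Sum>k\<le>n. qbinom (monom 1 1) n k * q_derangement k) = qfact (monom 1 1) n"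
    by (simp add: sum_qbinom_derangements)
qed

lemma q_derangement_0: "q_derangement 0 = 1"
  by (simp add: q_derangement_eq_qder_rec)

theorem q_derangement_Suc:
  "q_derangement (Suc n) =
     (\<Sum>i\<le>n. monom 1 i) * q_derangement n + (-1) ^ Suc n * monom 1 (Suc n choose 2)"
  by (simp add: q_derangement_eq_qder_rec qint_def monom_power lessThan_Suc_atMost)

section \<open>Likelihood ratio order and window sums\<close>

definition wsum :: "nat \<Rightarrow> (int \<Rightarrow> int) \<Rightarrow> int \<Rightarrow> int" where
  "wsum n u k = (\<Sum>i<n. u (k - int i))"

definition supp_pos :: "int \<Rightarrow> int \<Rightarrow> (int \<Rightarrow> int) \<Rightarrow> bool" where
  "supp_pos a b u \<longleftrightarrow> (\<forall>k. if a \<le> k \<and> k \<le> b then u k > 0 else u k = 0)"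

text \<open>The quotient u/v is nondecreasing, cross-multiplied to admit zeros. In the usual
  likelihood ratio order \<open>v\<close> is thus the smaller of the two sequences.\<close>

definition lr_le :: "(int \<Rightarrow> int) \<Rightarrow> (int \<Rightarrow> int) \<Rightarrow> bool" where
  "lr_le u v \<longleftrightarrow> (\<forall>a b. a < b \<longrightarrow> u a * v b \<le> u b * v a)"

lemma supp_posD:
  assumes "supp_pos a b u"
  shows "a \<le> k \<Longrightarrow> k \<le> b \<Longrightarrow> u k > 0" "k < a \<Longrightarrow> u k = 0" "k > b \<Longrightarrow> u k = 0" "u k \<ge> 0"
  using assms[unfolded supp_pos_def, rule_format, of k] by (auto split: if_splits)

lemma supp_pos_reflect: "supp_pos a b u \<Longrightarrow> supp_pos (c - b) (c - a) (\<lambda>k. u (c - k))"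
  unfolding supp_pos_def
proof (intro allI)
  fix k assume "\<forall>k. if a \<le> k \<and> k \<le> b then 0 < u k else u k = 0"
  from this[rule_format, of "c - k"]
  show "if c - b \<le> k \<and> k \<le> c - a then 0 < u (c - k) else u (c - k) = 0"
    by (auto split: if_splits)
qed

lemma lr_leD: "lr_le u v \<Longrightarrow> a < b \<Longrightarrow> u a * v b \<le> u b * v a"
  by (auto simp: lr_le_def)

text \<open>Adjacent inequalities chain because \<open>v\<close> is positive between the two
  indices; the nesting of the supports makes the left side 0 for all remaining pairs.\<close>

lemma lr_le_if_adjacent:
  assumes u: "supp_pos p r u" and v: "supp_pos p' r' v" and "p' \<le> p" "r' \<le> r"
    and adj: "\<And>k. p \<le> k \<Longrightarrow> k < r' \<Longrightarrow> u k * v (k + 1) \<le> u (k + 1) * v k"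
  shows "lr_le u v"
  unfolding lr_le_def
proof (intro allI impI)
  fix a b :: int assume "a < b"
  note u = supp_posD[OF u] and v = supp_posD[OF v]
  show "u a * v b \<le> u b * v a"
  proof (cases "p \<le> a \<and> b \<le> r'")
    case False
    hence "u a * v b = 0"
      using u v by auto
    moreover have "0 \<le> u b * v a"
      using u(4) v(4) by simp
    ultimately show ?thesis by linarith
  next
    case True
    from \<open>a < b\<close> have "b \<le> r' \<longrightarrow> u a * v b \<le> u b * v a"
    proof (induction b rule: int_gr_induct)
      case base
      then show ?case
        using adj True by simp
    next
      case (step b)
      show ?case
      proof
        assume b: "b + 1 \<le> r'"
        have "u a * v (b + 1) * v b \<le> u b * v a * v (b + 1)"
          using step b v(4) mult_right_mono[of "u a * v b" "u b * v a" "v (b + 1)"]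
          by (simp add: mult_ac)
        also have "\<dots> \<le> u (b + 1) * v a * v b"
          using adj[of b] step True b v(4) mult_left_mono[of "u b * v (b + 1)" "u (b + 1) * v b" "v a"]
          by (simp add: mult_ac)
        finally show "u a * v (b + 1) \<le> u (b + 1) * v a"
          using v(1)[of b] step True b \<open>p' \<le> p\<close> by simp
      qed
    qed
    then show ?thesis
      using True by simp
  qed
qed

lemma wsum_reflect: "wsum n (\<lambda>k. u (c - k)) k = wsum n u (c + int n - 1 - k)"
  unfolding wsum_def
  by (rule sum.reindex_bij_witness[where i = "\<lambda>i. n - 1 - i" and j = "\<lambda>i. n - 1 - i"])
     (auto simp: of_nat_diff algebra_simps)

lemma wsum_Suc: "wsum (Suc n) u k = u k + wsum n u (k - 1)"
  unfolding wsum_def by (subst sum.lessThan_Suc_shift) (simp add: algebra_simps)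

lemma wsum_Suc': "wsum (Suc n) u k = wsum n u k + u (k - int n)"
  by (simp add: wsum_def)

lemma wsum_diff: "wsum n u (k + 1) - wsum n u k = u (k + 1) - u (k + 1 - int n)"
  using wsum_Suc[of n u "k + 1"] wsum_Suc'[of n u "k + 1"] by simp

lemma supp_pos_wsum:
  assumes u: "supp_pos a b u" and "a \<le> b" "n > 0"
  shows "supp_pos a (b + int n - 1) (wsum n u)"
  unfolding supp_pos_def
proof (intro allI)
  fix k
  note u = supp_posD[OF u]
  show "if a \<le> k \<and> k \<le> b + int n - 1 then wsum n u k > 0 else wsum n u k = 0"
  proof (cases "a \<le> k \<and> k \<le> b + int n - 1")
    case True
    have "\<exists>i<n. a \<le> k - int i \<and> k - int i \<le> b"
    proof (cases "k \<le> b")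
      case True
      then show ?thesis
        using \<open>a \<le> k \<and> k \<le> b + int n - 1\<close> \<open>n > 0\<close> by (intro exI[of _ 0]) auto
    next
      case False
      then show ?thesis
        using True \<open>a \<le> b\<close> by (intro exI[of _ "nat (k - b)"]) auto
    qed
    then obtain i where "i < n" "u (k - int i) > 0"
      using u(1) by auto
    hence "wsum n u k > 0"
      unfolding wsum_def using u(4) by (intro sum_pos2[of _ i]) auto
    then show ?thesis
      using True by simp
  next
    case False
    hence "u (k - int i) = 0" if "i < n" for i
      using u(2)[of "k - int i"] u(3)[of "k - int i"] that by linarith
    then show ?thesis
      using False unfolding wsum_def by auto
  qed
qed

text \<open>The adjacent minors of two window sums are sums of minors of the original sequences
  (a Cauchy--Binet expansion: the window kernel is totally positive of order two).\<close>
lemma wsum_minor: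
  fixes u v :: "int \<Rightarrow> int"
  defines "m \<equiv> \<lambda>a b. u b * v a - u a * v b"
  assumes "n > 0"
  shows "wsum n u k * wsum n v (k - 1) - wsum n u (k - 1) * wsum n v k
    = (\<Sum>i=1..<n. m (k - int i) k) + (\<Sum>i=1..<n. m (k - int n) (k - int i)) + m (k - int n) k"
proof -
  obtain n' where n: "n = Suc n'"
    using assms(2) by (cases n) auto
  define R where "R = (\<lambda>u :: int \<Rightarrow> int. wsum n' u (k - 1))"
  have R: "(\<Sum>i=1..<n. w (k - int i)) = R w" for w :: "int \<Rightarrow> int"
    unfolding R_def wsum_def n
    by (rule sum.reindex_bij_witness[where i = Suc and j = "\<lambda>i. i - 1"])
       (auto simp: of_nat_diff algebra_simps)
  have "wsum n w k = w k + R w" for w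
    by (simp add: n R_def wsum_Suc)
  moreover have "wsum n w (k - 1) = R w + w (k - int n)" for w
    unfolding n R_def wsum_Suc' by (simp add: algebra_simps)
  moreover have "(\<Sum>i=1..<n. m (k - int i) k) = u k * R v - v k * R u"
    by (simp add: m_def sum_subtractf R[simplified] mult.commute flip: sum_distrib_left sum_distrib_right)
  moreover have "(\<Sum>i=1..<n. m (k - int n) (k - int i)) = R u * v (k - int n) - u (k - int n) * R v"
    by (simp add: m_def sum_subtractf R[simplified] mult.commute flip: sum_distrib_left sum_distrib_right)
  ultimately show ?thesis
    by (simp add: m_def algebra_simps)
qed

text \<open>Under the order every minor in the expansion is nonnegative, so any selection
  \<open>I\<close> of them gives a lower bound.\<close>

lemma wsum_minor_ge:
  assumes "lr_le u v" "I \<subseteq> {1..<n}" "n > 0"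
  shows "(\<Sum>i\<in>I. u k * v (k - int i) - u (k - int i) * v k)
      \<le> wsum n u k * wsum n v (k - 1) - wsum n u (k - 1) * wsum n v k"
proof -
  have "(\<Sum>i\<in>I. u k * v (k - int i) - u (k - int i) * v k)
     \<le> (\<Sum>i=1..<n. u k * v (k - int i) - u (k - int i) * v k)"
    using assms(2) lr_leD[OF assms(1)] by (intro sum_mono2) auto
  moreover have "(\<Sum>i=1..<n. u (k - int i) * v (k - int n) - u (k - int n) * v (k - int i)) \<ge> 0"
    using lr_leD[OF assms(1)] by (intro sum_nonneg) auto
  moreover have "u k * v (k - int n) - u (k - int n) * v k \<ge> 0"
    using lr_leD[OF assms(1), of "k - int n" k] assms(3) by simp
  ultimately show ?thesis
    using wsum_minor[OF assms(3), of u k v] by linarith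
qed

text \<open>The choice \<open>I = {1}\<close> keeps only the old adjacent minor; this is how
  strictness passes through a window sum.\<close>

lemma wsum_minor_adjacent:
  assumes "lr_le u v" "n \<ge> 2"
  shows "u (k + 1) * v k - u k * v (k + 1)
      \<le> wsum n u (k + 1) * wsum n v k - wsum n u k * wsum n v (k + 1)"
  using wsum_minor_ge[OF assms(1), of "{1}" n "k + 1"] assms(2) by simp

lemma lr_le_wsum:
  assumes "supp_pos p r u" "supp_pos p' r' v" "p \<le> r" "p' \<le> r'" "p' \<le> p" "r' \<le> r"
    and "lr_le u v" "n \<ge> 2"
  shows "lr_le (wsum n u) (wsum n v)"
proof (rule lr_le_if_adjacent)
  show "supp_pos p (r + int n - 1) (wsum n u)" "supp_pos p' (r' + int n - 1) (wsum n v)"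
    using assms by (auto intro: supp_pos_wsum)
  fix k
  show "wsum n u k * wsum n v (k + 1) \<le> wsum n u (k + 1) * wsum n v k"
    using wsum_minor_adjacent[OF assms(7,8), of k] lr_leD[OF assms(7), of k "k + 1"] by simp
qed (use assms in auto)

text \<open>With \<open>N = n choose 2\<close>, the two chains of ratios of the four residue classes of \<open>n\<close> modulo 4
  take the uniform forms \<open>f k / f (N - k)\<close> and \<open>f (N + 1 - k) / f k\<close>. Sequences are indexed by
  \<^typ>\<open>int\<close> and vanish outside their support, so that reflections and windows need no side conditions.\<close>
definition ratio_mono :: "int \<Rightarrow> (int \<Rightarrow> int) \<Rightarrow> bool" where
  "ratio_mono N f \<longleftrightarrow> (\<forall>k. 1 \<le> k \<and> k \<le> N - 2 \<longrightarrow> f k * f (N - k - 1) < f (k + 1) * f (N - k))"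

definition coratio_mono :: "int \<Rightarrow> (int \<Rightarrow> int) \<Rightarrow> bool" where
  "coratio_mono N f \<longleftrightarrow> (\<forall>k. 2 \<le> k \<and> k \<le> N - 2 \<longrightarrow> f (N + 1 - k) * f (k + 1) < f (N - k) * f k)"

text \<open>The inequality is invariant under replacing \<open>k\<close> by
  \<open>N - 1 - k\<close>.\<close>

lemma ratio_mono_halfI:
  assumes "\<And>k. 1 \<le> k \<Longrightarrow> 2 * k \<le> N - 1 \<Longrightarrow> f k * f (N - k - 1) < f (k + 1) * f (N - k)"
  shows "ratio_mono N f"
  unfolding ratio_mono_def
proof (intro allI impI)
  fix k assume k: "1 \<le> k \<and> k \<le> N - 2"
  show "f k * f (N - k - 1) < f (k + 1) * f (N - k)"
    using assms[of k] assms[of "N - 1 - k"] k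
    by (cases "2 * k \<le> N - 1") (simp_all add: algebra_simps)
qed

lemma coratio_mono_halfI:
  assumes "\<And>k. 2 \<le> k \<Longrightarrow> 2 * k \<le> N \<Longrightarrow> f (N + 1 - k) * f (k + 1) < f (N - k) * f k"
  shows "coratio_mono N f"
  unfolding coratio_mono_def
proof (intro allI impI)
  fix k assume k: "2 \<le> k \<and> k \<le> N - 2"
  show "f (N + 1 - k) * f (k + 1) < f (N - k) * f k"
    using assms[of k] assms[of "N - k"] k
    by (cases "2 * k \<le> N") (simp_all add: algebra_simps)
qed

lemma lr_le_of_ratio_mono:
  assumes "supp_pos 1 T f" "T \<in> {N - 1, N}" "ratio_mono N f"
  shows "lr_le f (\<lambda>k. f (N - k))"
proof (rule lr_le_if_adjacent)
  show "supp_pos 1 T f" "supp_pos (N - T) (N - 1) (\<lambda>k. f (N - k))"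
    using assms by (auto intro: supp_pos_reflect)
  fix k assume "1 \<le> k" "k < N - 1"
  then show "f k * f (N - (k + 1)) \<le> f (k + 1) * f (N - k)"
    using assms(3)[unfolded ratio_mono_def, rule_format, of k] by (simp add: diff_diff_eq)
qed (use assms in auto)

text \<open>The top of the support must be \<open>N - 1\<close>: an entry at \<open>N\<close> would
  be reflected to position 1, where \<open>coratio_mono\<close> says nothing.\<close>

lemma lr_le_of_coratio_mono:
  assumes "supp_pos 1 (N - 1) f" "coratio_mono N f"
  shows "lr_le (\<lambda>k. f (N + 1 - k)) f"
proof (rule lr_le_if_adjacent)
  show "supp_pos 1 (N - 1) f"
    by fact
  from supp_pos_reflect[OF this, of "N + 1"]
  show "supp_pos 2 N (\<lambda>k. f (N + 1 - k))"
    by simp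
  fix k assume "2 \<le> k" "k < N - 1"
  then show "f (N + 1 - k) * f (k + 1) \<le> f (N + 1 - (k + 1)) * f k"
    using assms(2)[unfolded coratio_mono_def, rule_format, of k] by simp
qed auto

lemma ratio_mono_step:
  assumes g: "supp_pos 1 T g" "T \<in> {M - 1, M}" "ratio_mono M g"
    and n: "n \<ge> 2" and N: "N = M + int n - 1" "N + 3 \<le> 2 * M"
    and f: "\<And>k. k < N \<Longrightarrow> f k = wsum n g k"
  shows "ratio_mono N f"
proof (rule ratio_mono_halfI)
  fix k assume k: "1 \<le> k" "2 * k \<le> N - 1"
  \<comment> \<open>The window shifts the reflection from \<open>M\<close> to \<open>N\<close>;
    \<open>j \<ge> 1\<close> keeps \<open>N - j\<close> below the correction term at
    \<open>N\<close>.\<close>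
  have refl: "wsum n (\<lambda>k. g (M - k)) j = f (N - j)" if "j \<ge> 1" for j
    using that N by (simp add: wsum_reflect f)
  have "g k * g (M - k - 1) < g (k + 1) * g (M - k)"
    using g(3)[unfolded ratio_mono_def, rule_format, of k] k N by simp
  then show "f k * f (N - k - 1) < f (k + 1) * f (N - k)"
    using wsum_minor_adjacent[OF lr_le_of_ratio_mono[OF g] n, of k] refl[of k] refl[of "k + 1"] f[of k] f[of "k + 1"] k
    by (simp add: diff_diff_eq)
qed

lemma coratio_mono_step:
  assumes g: "supp_pos 1 (M - 1) g" "coratio_mono M g"
    and n: "n \<ge> 2" and N: "N = M + int n - 1" "N + 4 \<le> 2 * M"
    and f: "\<And>k. k < N \<Longrightarrow> f k = wsum n g k"
  shows "coratio_mono N f"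
proof (rule coratio_mono_halfI)
  fix k assume k: "2 \<le> k" "2 * k \<le> N"
  have refl: "wsum n (\<lambda>k. g (M + 1 - k)) j = f (N + 1 - j)" if "j \<ge> 2" for j
    using that N by (simp add: wsum_reflect f algebra_simps)
  have "g (M + 1 - k) * g (k + 1) < g (M - k) * g k"
    using g(2)[unfolded coratio_mono_def, rule_format, of k] k N by simp
  then show "f (N + 1 - k) * f (k + 1) < f (N - k) * f k"
    using wsum_minor_adjacent[OF lr_le_of_coratio_mono[OF g] n, of k] refl[of k] refl[of "k + 1"] f[of k] f[of "k + 1"] k
    by simp
qed

text \<open>The chains interlock as \<open>f k \<le> f (N - k) \<le> f (k + 1)\<close>: comparing an
  index with its mirror image turns the cross products into squares.\<close>

lemma mono_if_ratio_mono:
  assumes "supp_pos 1 (N - 1) f" "ratio_mono N f" "coratio_mono N f" "2 * k < N"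
  shows "f k \<le> f (k + 1)"
proof (cases "k \<ge> 1")
  case True
  note nn = supp_posD(4)[OF assms(1)]
  have "f k * f k \<le> f (N - k) * f (N - k)"
    using lr_leD[OF lr_le_of_ratio_mono[OF assms(1) _ assms(2)], of k "N - k"] assms(4) by simp
  hence 1: "f k \<le> f (N - k)"
    using nn by (simp add: power2_eq_square[symmetric] power_mono_iff)
  have "f (N - k) * f (N - k) \<le> f (k + 1) * f (k + 1)"
  proof (cases "k + 1 = N - k")
    case False
    then show ?thesis
      using lr_leD[OF lr_le_of_coratio_mono[OF assms(1,3)], of "k + 1" "N - k"] assms(4) by (simp add: algebra_simps)
  qed (metis order_refl)
  hence "f (N - k) \<le> f (k + 1)"
    using nn by (simp add: power2_eq_square[symmetric] power_mono_iff)
  with 1 show ?thesis by simp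
next
  case False
  then show ?thesis
    using supp_posD(2,4)[OF assms(1)] by simp
qed

section \<open>Two steps of the recurrence\<close>

lemma wsum_window: "wsum n u k = (\<Sum>j\<in>{k - int n<..k}. u j)"
  unfolding wsum_def
  by (rule sum.reindex_bij_witness[where i = "\<lambda>j. nat (k - j)" and j = "\<lambda>i. k - int i"]) auto

lemma wsum_indicator_1:
  "wsum n (\<lambda>k. u k - (if k = c then 1 else 0)) k
    = wsum n u k - (if c \<le> k \<and> k < c + int n then 1 else 0)"
  by (simp add: wsum_window sum_subtractf)

text \<open>Here \<open>P\<close> stands for the coefficients of index \<open>n - 2\<close> with \<open>n\<close> odd. The coefficients of index
  \<open>n - 1\<close> are \<open>Q\<close> plus 1 at the top position \<open>M\<close>; that extra 1 violates the order at the end,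
  so the second chain has to be carried from \<open>P\<close> to index \<open>n\<close> in one go.\<close>
locale odd_step =
  fixes P :: "int \<Rightarrow> int" and L :: int and n :: nat
  assumes P: "supp_pos 1 (L - 1) P" and P_ratio: "ratio_mono L P" and P_coratio: "coratio_mono L P"
    and n9: "n \<ge> 9" and L: "2 * int n + 1 \<le> L"
    and P1: "P 1 = 1" and P2: "P 2 = int n - 4"
    and P3: "2 * P 3 = (int n - 3) * (int n - 4) - 2"
    and PL1: "2 * P (L - 1) = int n - 3" and PL2: "4 * P (L - 2) = (int n - 3)\<^sup>2"
begin

definition M where "M = L + int n - 2"
definition N where "N = M + int n - 1"
definition Q where "Q = wsum (n - 1) P"
definition c where "c = (\<lambda>k. Q (M + 1 - k))"

lemma n_minus_1: "int (n - 1) = int n - 1" "n - 1 > 0" "n - 1 \<ge> 2" "int (n - Suc 0) = int n - 1"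
  using n9 by auto

lemma c_altdef: "c = wsum (n - 1) (\<lambda>k. P (L + 1 - k))"
  unfolding c_def Q_def
  by (rule ext) (simp add: wsum_reflect M_def n_minus_1 algebra_simps)

lemma supp_Q: "supp_pos 1 (M - 1) Q"
  using supp_pos_wsum[OF P _ n_minus_1(2)] L n9 by (simp add: Q_def M_def n_minus_1 algebra_simps)

lemma supp_c: "supp_pos 2 M c"
  using supp_pos_reflect[OF supp_Q, of "M + 1"] by (simp add: c_def)

lemma supp_Prefl: "supp_pos 2 L (\<lambda>k. P (L + 1 - k))"
  using supp_pos_reflect[OF P, of "L + 1"] by simp

lemma lr_le_c_Q: "lr_le c Q"
  unfolding Q_def c_altdef
  by (rule lr_le_wsum[OF supp_Prefl P _ _ _ _ lr_le_of_coratio_mono[OF P P_coratio] n_minus_1(3)]) (use L n9 in auto)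

definition Q' where "Q' = (\<lambda>k. Q k - (if 1 \<le> k \<and> k < int n then 1 else 0))"

text \<open>The entry \<open>P 1\<close> faces \<open>P L = 0\<close> in the minors, so it can be deleted without
  destroying the likelihood ratio order.\<close>
lemma lr_le_c_Q': "lr_le c Q'"
proof -
  define P' where "P' = (\<lambda>k. P k - (if k = 1 then 1 else 0))"
  have P': "supp_pos 2 (L - 1) P'"
    unfolding supp_pos_def
  proof (intro allI)
    fix k show "if 2 \<le> k \<and> k \<le> L - 1 then 0 < P' k else P' k = 0"
      using P[unfolded supp_pos_def, rule_format, of k] P1 L n9 by (auto simp: P'_def)
  qed
  have lrP': "lr_le (\<lambda>k. P (L + 1 - k)) P'"
  proof (rule lr_le_if_adjacent[OF supp_Prefl P'])
    fix k :: int assume "2 \<le> k"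
    then show "P (L + 1 - k) * P' (k + 1) \<le> P (L + 1 - (k + 1)) * P' k"
      using lr_leD[OF lr_le_of_coratio_mono[OF P P_coratio], of k "k + 1"] by (simp add: P'_def)
  qed auto
  have eq: "Q' = wsum (n - 1) P'"
    by (rule ext) (simp add: P'_def wsum_indicator_1 Q'_def Q_def n_minus_1)
  show ?thesis
    unfolding c_altdef eq
    by (rule lr_le_wsum[OF supp_Prefl P' _ _ _ _ lrP' n_minus_1(3)]) (use L n9 in auto)
qed

section \<open>Values and comparisons near the ends of \<open>Q\<close> and its reflection\<close>

lemma P_nonpos: "k \<le> 0 \<Longrightarrow> P k = 0" and P_ge_L: "k \<ge> L \<Longrightarrow> P k = 0"
  using supp_posD[OF P] by auto

lemma Q_eq_sum: "k < int n \<Longrightarrow> Q k = (\<Sum>j=1..k. P j)"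
  unfolding Q_def wsum_window n_minus_1
  by (rule sum.mono_neutral_right) (auto intro!: P_nonpos)

lemma atLeastAtMost_int_num:
  "{1..1::int} = {1}" "{1..2::int} = {1, 2}" "{1..3::int} = {1, 2, 3}" "{1..4::int} = {1, 2, 3, 4}"
  by auto

lemma Q1: "Q 1 = 1" and Q2: "Q 2 = int n - 3" and Q3: "Q 3 = int n - 3 + P 3"
  and Q4: "Q 4 = int n - 3 + P 3 + P 4"
  using Q_eq_sum[of 1] Q_eq_sum[of 2] Q_eq_sum[of 3] Q_eq_sum[of 4] n9
  by (simp_all add: atLeastAtMost_int_num P1 P2)

lemma c1: "c 1 = 0"
  using supp_posD(2)[OF supp_c] by simp

lemma c_eq_sum:
  assumes "k < int n"
  shows "c k = (\<Sum>j=1..k. P (L + 1 - j))"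
proof -
  have "c k = (\<Sum>j\<in>{k - int (n - 1)<..k}. P (L + 1 - j))"
    by (simp add: c_altdef wsum_window)
  also have "\<dots> = (\<Sum>j=1..k. P (L + 1 - j))"
    using assms n_minus_1 by (intro sum.mono_neutral_right) (auto intro!: P_ge_L)
  finally show ?thesis .
qed

lemma c2: "c 2 = P (L - 1)" and c3: "c 3 = P (L - 1) + P (L - 2)"
  using c_eq_sum[of 2] c_eq_sum[of 3] n9
  by (simp_all add: atLeastAtMost_int_num P_ge_L)

lemma Q_eq_2c: "Q 2 = 2 * c 2"
  using PL1 by (simp add: Q2 c2)

text \<open>After multiplication by 4 the two sides differ by just \<open>2 * (int n - 1)\<close>,
  which comes from the \<open>- 2\<close> in the formula for \<open>P 3\<close>.\<close>

lemma c3_bound: "(1 + c 2) * Q 3 < (1 + Q 2) * c 3"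
proof -
  have c: "2 + 2 * c 2 = int n - 1" "4 * c 3 = (int n - 1) * (int n - 3)"
    using PL1 PL2 by (simp_all add: c2 c3 power2_eq_square algebra_simps)
  have q: "2 * Q 3 = (int n - 2) * (int n - 3) - 2" "1 + Q 2 = int n - 2"
    using P3 by (simp_all add: Q3 Q2 algebra_simps)
  have "4 * ((1 + c 2) * Q 3) = (2 + 2 * c 2) * (2 * Q 3)"
    by (simp add: algebra_simps)
  also have "\<dots> = (int n - 1) * ((int n - 2) * (int n - 3) - 2)"
    unfolding c q ..
  also have "\<dots> < (int n - 1) * ((int n - 2) * (int n - 3))"
    using n9 by simp
  also have "\<dots> = (1 + Q 2) * (4 * c 3)"
    unfolding c q by (simp add: algebra_simps)
  finally show ?thesis by simp
qed

lemma M_gt: "M > int n + 2"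
  using L n9 by (simp add: M_def)

lemma c_pos: "2 \<le> b \<Longrightarrow> b \<le> M \<Longrightarrow> c b > 0"
  using supp_posD(1)[OF supp_c] .

lemma Q_le_2c:
  assumes "2 \<le> b" "b \<le> M"
  shows "Q b \<le> 2 * c b"
proof (cases "b = 2")
  case False
  have "c 2 * Q b \<le> c 2 * (2 * c b)"
    using lr_leD[OF lr_le_c_Q, of 2 b] assms False Q_eq_2c by (simp add: mult_ac)
  then show ?thesis
    using c_pos[of 2] M_gt by simp
qed (simp add: Q_eq_2c)

text \<open>Q/c is nonincreasing, so the bound at 3 propagates upwards. It fails at 2, where
  \<open>Q 2 = 2 * c 2\<close>.\<close>

lemma c_bound:
  assumes "3 \<le> b" "b \<le> M"
  shows "(1 + c 2) * Q b < (1 + Q 2) * c b"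
proof (cases "b = 3")
  case False
  have "c 3 * ((1 + c 2) * Q b) \<le> (1 + c 2) * (c b * Q 3)"
    using lr_leD[OF lr_le_c_Q, of 3 b] assms False c_pos[of 2] M_gt
      mult_left_mono[of "c 3 * Q b" "c b * Q 3" "1 + c 2"] by (simp add: mult_ac)
  also have "\<dots> = c b * ((1 + c 2) * Q 3)"
    by (simp add: mult_ac)
  also have "\<dots> < c b * ((1 + Q 2) * c 3)"
    using c3_bound c_pos[of b] assms by (intro mult_strict_left_mono) auto
  finally have "c 3 * ((1 + c 2) * Q b) < c 3 * ((1 + Q 2) * c b)"
    by (simp add: mult_ac)
  then show ?thesis
    using c_pos[of 3] M_gt by simp
qed (simp add: c3_bound)

lemma Q_less_2c:
  assumes "3 \<le> b" "b \<le> M"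
  shows "Q b < 2 * c b"
proof -
  have "(1 + c 2) * Q b < (1 + c 2) * (2 * c b)"
    using c_bound[OF assms] c_pos[of b] assms by (simp add: Q_eq_2c algebra_simps)
  then show ?thesis
    using c_pos[of 2] M_gt by simp
qed

lemma int_mono_upto:
  fixes u :: "int \<Rightarrow> int"
  assumes "a \<le> b" "b \<le> B" "\<And>k. k < B \<Longrightarrow> u k \<le> u (k + 1)"
  shows "u a \<le> u b"
  using assms(1,2)
proof (induction b rule: int_ge_induct)
  case (step b)
  then show ?case
    using assms(3)[of b] by simp
qed simp

text \<open>The bound \<open>2 * int n + 1 \<le> L\<close> places all indices up to
  \<open>int n + 1\<close> on the rising half of \<open>P\<close>.\<close>

lemma P_mono: "a \<le> b \<Longrightarrow> b \<le> int n + 1 \<Longrightarrow> P a \<le> P b"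
  by (rule int_mono_upto[where B = "int n + 1" and u = P]) (use mono_if_ratio_mono[OF P P_ratio P_coratio] L in auto)

lemma Q_mono: "a \<le> b \<Longrightarrow> b \<le> int n + 1 \<Longrightarrow> Q a \<le> Q b"
proof (rule int_mono_upto[where B = "int n + 1" and u = Q and a = a and b = b])
  fix k assume "k < int n + 1"
  hence "P (k + 1 - int (n - 1)) \<le> P (k + 1)"
    by (intro P_mono) auto
  then show "Q k \<le> Q (k + 1)"
    using wsum_diff[of "n - 1" P k] by (simp add: Q_def)
qed

text \<open>A saving in the critical case of \<open>f_minor\<close>: three terms of a window sum of
  \<open>n\<close> terms cost only as much as the largest one. \<open>n \<ge> 9\<close> ensures that
  the window behind \<open>Q (int n + 1)\<close> contains 3, ..., 10.\<close>

lemma Q234: "Q 2 + Q 3 + Q 4 \<le> Q (int n + 1)"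
proof -
  have "{3..10::int} = {3, 4, 5, 6, 7, 8, 9, 10}"
    by auto
  hence "(\<Sum>j=3..10. P j) = P 3 + P 4 + P 5 + P 6 + P 7 + P 8 + P 9 + P 10"
    by simp
  moreover have "(\<Sum>j=3..10. P j) \<le> (\<Sum>j\<in>{int n + 1 - int (n - 1)<..int n + 1}. P j)"
    using n9 supp_posD(4)[OF P] by (intro sum_mono2) auto
  moreover have "P 3 \<le> P 5" "P 2 \<le> P 6" "P 2 \<le> P 7" "P 2 \<le> P 8" "P 2 \<le> P 9" "P 2 \<le> P 10"
    using n9 by (auto intro!: P_mono)
  moreover have "Q (int n + 1) = (\<Sum>j\<in>{int n + 1 - int (n - 1)<..int n + 1}. P j)"
    by (simp only: Q_def wsum_window)
  ultimately show ?thesis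
    unfolding Q2 Q3 Q4 using n9 P2 by linarith
qed

text \<open>The coefficients of index \<open>n\<close>: the extra 1 at \<open>M\<close> spreads over
  \<open>M\<close>, ..., \<open>N\<close>, and the correction -1 removes it at
  \<open>N\<close>.\<close>

definition f where "f k = wsum n Q k + (if M \<le> k \<and> k < N then 1 else 0)"

text \<open>With the minor \<open>D\<close> of the window sums of \<open>c\<close> and
  \<open>Q\<close>, the difference of the two sides is \<open>D\<close> for
  \<open>K \<ge> int n + 2\<close>, \<open>D - Q K\<close> for \<open>K \<le> int n\<close>, and
  \<open>D - V K\<close> for \<open>K = int n + 1\<close>, where only \<open>f (N + 2 - K)\<close>
  receives the extra 1.\<close>

lemma f_minor:
  assumes "3 \<le> K" "2 * K \<le> N + 2"
  shows "f (N + 2 - K) * f K < f (N + 1 - K) * f (K - 1)"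
proof -
  define U where "U = wsum n c"
  define V where "V = wsum n Q"
  note pos = supp_posD[OF supp_Q] supp_posD[OF supp_c]
  have KM: "K < M"
    using assms L n9 by (simp add: N_def M_def)
  have U: "U k = V (N + 1 - k)" for k
    unfolding U_def V_def c_def wsum_reflect by (simp add: N_def algebra_simps)
  have f: "f K = V K" "f (K - 1) = V (K - 1)"
    using KM by (auto simp: f_def V_def)
  have shift: "N + 1 - (K - 1) = N + 2 - K"
    by simp
  have fr: "f (N + 1 - K) = U K + (if K \<le> int n then 1 else 0)"
    unfolding U using assms by (auto simp: f_def V_def N_def)
  have fr': "f (N + 2 - K) = U (K - 1) + (if K \<le> int n + 1 then 1 else 0)"
    unfolding U shift using assms by (auto simp: f_def V_def N_def)
  define D where "D = U K * V (K - 1) - U (K - 1) * V K"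
  have Dge: "(\<Sum>i\<in>I. c K * Q (K - int i) - c (K - int i) * Q K) \<le> D" if "I \<subseteq> {1..<n}" for I
    unfolding D_def U_def V_def
    using wsum_minor_ge[OF lr_le_c_Q that] n9 by simp
  consider "K \<ge> int n + 2" | "K = int n + 1" | "K \<le> int n"
    by linarith
  then show ?thesis
  proof cases
    case 1
    have "2 \<le> K - 1 \<and> K - 1 \<le> L - 2"
      using assms L 1 n9 by (simp add: N_def M_def)
    from P_coratio[unfolded coratio_mono_def, rule_format, OF this]
    have "0 < c K * Q (K - 1) - c (K - 1) * Q K"
      using wsum_minor_adjacent[OF lr_le_of_coratio_mono[OF P P_coratio] n_minus_1(3), of "K - 1"]
      by (simp add: c_altdef Q_def algebra_simps)
    hence "0 < D"
      using Dge[of "{1}"] n9 by simp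
    then show ?thesis
      using 1 by (simp add: f fr fr' D_def)
  next
    case 3
    have "V K - V (K - 1) = Q K"
      using wsum_diff[of n Q "K - 1"] pos(2)[of "K - int n"] 3 by (simp add: V_def)
    moreover have "Q K < D"
    proof -
      \<comment> \<open>These offsets select the minors of \<open>K\<close> against positions 2 and
        1; with \<open>Q 1 = 1\<close> and \<open>c 1 = 0\<close> their sum exceeds
        \<open>Q K\<close> precisely by \<open>c_bound\<close>.\<close>
      have "{nat (K - 2), nat (K - 1)} \<subseteq> {1..<n}" "nat (K - 2) \<noteq> nat (K - 1)"
        using assms 3 by auto
      from Dge[OF this(1)] this(2)
      have "(c K * Q 2 - c 2 * Q K) + (c K * Q 1 - c 1 * Q K) \<le> D"
        using assms by simp
      then show ?thesis
        using c_bound[of K] assms KM by (simp add: Q1 c1 algebra_simps)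
    qed
    ultimately show ?thesis
      using 3 unfolding f fr fr' by (simp add: D_def algebra_simps)
  next
    case 2
    define c' Q'' where "c' = c (int n + 1)" and "Q'' = Q (int n + 1)"
    have D: "(int n - 2) * c' + (\<Sum>b=2..int n + 1. c b) \<le> D"
    proof -
      have "(int n - 2) * c' = (\<Sum>i\<in>{2..<n}. c')"
        using n9 by (simp add: of_nat_diff)
      also have "\<dots> \<le> (\<Sum>i\<in>{2..<n}. c K * Q (K - int i) - c (K - int i) * Q K)"
      proof (rule sum_mono)
        fix i assume i: "i \<in> {2..<n}"
        \<comment> \<open>\<open>Q'\<close> equals \<open>Q - 1\<close> at \<open>K - int i\<close>,
          which lies between 2 and \<open>int n - 1\<close>, but equals \<open>Q\<close> at
          \<open>K\<close>; the order of \<open>c\<close> and \<open>Q'\<close> therefore improves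
          the minor by \<open>c K\<close>.\<close>
        show "c' \<le> c K * Q (K - int i) - c (K - int i) * Q K"
          using lr_leD[OF lr_le_c_Q', of "K - int i" K] i 2 by (simp add: Q'_def c'_def algebra_simps)
      qed
      also have "\<dots> \<le> (\<Sum>i=1..<n. c K * Q (K - int i) - c (K - int i) * Q K)"
        using lr_leD[OF lr_le_c_Q] by (intro sum_mono2) auto
      finally have 1: "(int n - 2) * c' \<le> \<dots>" .
      \<comment> \<open>The other minors of the expansion are taken against position 1, where
        \<open>c\<close> is 0 and \<open>Q\<close> is 1, so each reduces to a value of
        \<open>c\<close>.\<close>
      have Kn: "K - int n = 1"
        using 2 by simp
      have "(\<Sum>b=2..int n + 1. c b) = (\<Sum>i=0..<n. c (K - int i))"
        by (rule sum.reindex_bij_witness[where i = "\<lambda>i. K - int i" and j = "\<lambda>b. nat (K - b)"])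
           (auto simp: 2)
      also have "\<dots> = c K + (\<Sum>i=1..<n. c (K - int i))"
        using n9 by (simp add: sum.atLeast_Suc_lessThan)
      finally show ?thesis
        using 1 wsum_minor[of n c K Q] n9 unfolding Kn
        by (simp add: D_def U_def V_def Q1 c1)
    qed
    have V: "V K = (\<Sum>b=2..int n + 1. Q b)"
      unfolding V_def wsum_window by (rule sum.cong) (auto simp: 2)
    have "(\<Sum>b=2..int n + 1. Q b) = Q 2 + Q 3 + Q 4 + (\<Sum>b=5..int n + 1. Q b)"
    proof -
      have "{2..int n + 1} = {2, 3, 4} \<union> {5..int n + 1}"
        using n9 by auto
      then show ?thesis
        by (simp add: sum.union_disjoint)
    qed
    also have "\<dots> \<le> Q'' + (\<Sum>b=5..int n + 1. Q'')"
      unfolding Q''_def by (intro add_mono Q234 sum_mono Q_mono) auto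
    also have "\<dots> = (int n - 2) * Q''"
      using n9 by (simp add: algebra_simps)
    also have "\<dots> < (int n - 2) * (2 * c')"
      unfolding Q''_def c'_def using n9 L by (intro mult_strict_left_mono Q_less_2c) (auto simp: M_def)
    finally have "(\<Sum>b=2..int n + 1. Q b) < 2 * ((int n - 2) * c')"
      by simp
    moreover have "(\<Sum>b=2..int n + 1. Q b) \<le> 2 * (\<Sum>b=2..int n + 1. c b)"
      unfolding sum_distrib_left using L n9 by (intro sum_mono Q_le_2c) (auto simp: M_def)
    \<comment> \<open>Adding the two bounds on \<open>V K\<close> gives
      \<open>2 * V K < 2 * D\<close>: each half of \<open>D\<close> pays for half of the window
      sum.\<close>
    ultimately have "V K < D"
      using D V by linarith
    then show ?thesis
      using 2 unfolding f fr fr' by (simp add: D_def algebra_simps)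
  qed
qed

lemma supp_f: "supp_pos 1 (N - 1) f"
  unfolding supp_pos_def
proof (intro allI)
  have *: "supp_pos 1 (N - 1) (wsum n Q)"
    using supp_pos_wsum[OF supp_Q, of n] L n9 by (simp add: N_def M_def)
  fix k show "if 1 \<le> k \<and> k \<le> N - 1 then 0 < f k else f k = 0"
    using *[unfolded supp_pos_def, rule_format, of k] M_gt by (auto simp: f_def)
qed

lemma coratio_mono_f: "coratio_mono N f"
proof (rule coratio_mono_halfI)
  fix k :: int assume "2 \<le> k" "2 * k \<le> N"
  hence "f (N + 2 - (k + 1)) * f (k + 1) < f (N + 1 - (k + 1)) * f (k + 1 - 1)"
    by (intro f_minor) auto
  moreover have "N + 2 - (k + 1) = N + 1 - k" "N + 1 - (k + 1) = N - k" "k + 1 - 1 = k"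
    by auto
  ultimately show "f (N + 1 - k) * f (k + 1) < f (N - k) * f k"
    by (simp only:)
qed

lemma f_eq_sum:
  assumes "k < int n"
  shows "f k = (\<Sum>j=1..k. Q j)"
proof -
  have "f k = (\<Sum>j\<in>{k - int n<..k}. Q j)"
    using assms M_gt by (simp add: f_def wsum_window)
  also have "\<dots> = (\<Sum>j=1..k. Q j)"
    using assms supp_posD(2)[OF supp_Q] by (intro sum.mono_neutral_right) auto
  finally show ?thesis .
qed

lemma f_refl_eq_sum:
  assumes "2 \<le> k" "k < int n"
  shows "f (N + 1 - k) = (\<Sum>j=1..k. c j) + 1"
proof -
  have "wsum n Q (N + 1 - k) = wsum n c k"
    unfolding c_def wsum_reflect by (simp add: N_def algebra_simps)
  also have "\<dots> = (\<Sum>j=1..k. c j)"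
    unfolding wsum_window using assms supp_posD(2)[OF supp_c] by (intro sum.mono_neutral_right) auto
  finally show ?thesis
    using assms by (simp add: f_def N_def)
qed

text \<open>The assumptions on the ends of \<open>P\<close> return with \<open>n - 2\<close>
  replaced by \<open>n\<close>, so the locale can be entered again.\<close>

lemma f_initial: "f 1 = 1" "f 2 = int n - 2" "2 * f 3 = (int n - 1) * (int n - 2) - 2"
  using f_eq_sum[of 1] f_eq_sum[of 2] f_eq_sum[of 3] n9 P3
  by (simp_all add: atLeastAtMost_int_num Q1 Q2 Q3 algebra_simps)

lemma f_final: "2 * f (N - 1) = int n - 1" "4 * f (N - 2) = (int n - 1)\<^sup>2"
  using f_refl_eq_sum[of 2] f_refl_eq_sum[of 3] n9 PL1 PL2
  by (simp_all add: atLeastAtMost_int_num c1 c2 c3 power2_eq_square algebra_simps)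

end

section \<open>Ratio monotonicity of the coefficients\<close>

definition dcoef :: "nat \<Rightarrow> int \<Rightarrow> int" where
  "dcoef n k = (if k < 0 then 0 else coeff (q_derangement n) (nat k))"

definition tri :: "nat \<Rightarrow> int" where
  "tri n = int (n choose 2)"

lemma tri_Suc: "tri (Suc n) = tri n + int n"
  by (simp add: tri_def numeral_2_eq_2)

lemma two_tri: "2 * tri n = int n * (int n - 1)"
  by (induction n) (simp_all add: tri_Suc algebra_simps, simp add: tri_def)

lemma dcoef_Suc:
  "dcoef (Suc n) k = wsum (Suc n) (dcoef n) k + (if k = tri (Suc n) then (-1) ^ Suc n else 0)"
proof (cases "k < 0")
  case True
  then show ?thesis
    by (simp add: dcoef_def wsum_def tri_def)
next
  case False
  have "coeff ((-1) ^ Suc n * monom 1 (Suc n choose 2)) (nat k)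
      = (if k = tri (Suc n) then (-1) ^ Suc n else (0::int))"
    using False by (cases "even n") (auto simp: tri_def simp del: binomial_Suc_Suc binomial_Suc_n)
  moreover have "coeff ((\<Sum>i\<le>n. monom 1 i) * q_derangement n) (nat k) = wsum (Suc n) (dcoef n) k"
    unfolding wsum_def sum_distrib_right coeff_sum lessThan_Suc_atMost
    using False by (intro sum.cong) (auto simp: coeff_monom_mult dcoef_def nat_diff_distrib)
  ultimately show ?thesis
    using False by (simp add: dcoef_def q_derangement_Suc del: binomial_Suc_Suc power_Suc)
qed

text \<open>The data that \<open>odd_step\<close> requires of index \<open>n\<close>. Even indices
  only need the two chains, because the next second chain is derived from the preceding odd
  index.\<close>

definition odd_inv :: "nat \<Rightarrow> bool" where
  "odd_inv n \<longleftrightarrow> supp_pos 1 (tri n - 1) (dcoef n) \<and> ratio_mono (tri n) (dcoef n) \<and> coratio_mono (tri n) (dcoef n)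
     \<and> dcoef n 1 = 1 \<and> dcoef n 2 = int n - 2 \<and> 2 * dcoef n 3 = (int n - 1) * (int n - 2) - 2
     \<and> 2 * dcoef n (tri n - 1) = int n - 1 \<and> 4 * dcoef n (tri n - 2) = (int n - 1)\<^sup>2"

definition even_inv :: "nat \<Rightarrow> bool" where
  "even_inv n \<longleftrightarrow> supp_pos 1 (tri n) (dcoef n) \<and> ratio_mono (tri n) (dcoef n) \<and> coratio_mono (tri n) (dcoef n)"

lemma inv_step:
  assumes n: "odd n" "n \<ge> 7" and inv: "odd_inv n"
  shows "even_inv (Suc n)" "odd_inv (Suc (Suc n))"
proof -
  \<comment> \<open>From \<open>n - 1 \<ge> 6\<close>; hence \<open>tri n \<ge> 3 * int n\<close>,
    enough for the size assumption on \<open>L\<close>.\<close>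
  have "int n * 6 \<le> 2 * tri n"
    unfolding two_tri using n by (intro mult_left_mono) auto
  hence tri_ge: "2 * int (Suc (Suc n)) + 1 \<le> tri n"
    using n(2) by simp
  interpret odd_step "dcoef n" "tri n" "Suc (Suc n)"
    by unfold_locales (use inv n tri_ge in \<open>auto simp: odd_inv_def\<close>)
  have M: "M = tri (Suc n)"
    by (simp add: M_def tri_Suc)
  have N: "N = tri (Suc (Suc n))"
    by (simp add: N_def M tri_Suc)
  have g: "dcoef (Suc n) = (\<lambda>k. Q k + (if k = M then 1 else 0))"
    using n by (auto simp: dcoef_Suc Q_def M)
  have h: "dcoef (Suc (Suc n)) = f"
  proof (rule ext)
    fix k
    have "wsum (Suc (Suc n)) (dcoef (Suc n)) k = wsum (Suc (Suc n)) Q k + (if M \<le> k \<and> k \<le> N then 1 else 0)"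
      unfolding g wsum_window sum.distrib by (auto simp: N_def)
    then show "dcoef (Suc (Suc n)) k = f k"
      using n M_gt by (auto simp: dcoef_Suc[of "Suc n"] f_def N[symmetric] N_def)
  qed
  have suppg: "supp_pos 1 M (dcoef (Suc n))"
    unfolding supp_pos_def
  proof (intro allI)
    fix k show "if 1 \<le> k \<and> k \<le> M then dcoef (Suc n) k > 0 else dcoef (Suc n) k = 0"
      using supp_Q[unfolded supp_pos_def, rule_format, of k] M_gt by (auto simp: g)
  qed
  have gw: "dcoef (Suc n) k = wsum (Suc n) (dcoef n) k" if "k < M" for k
    using that by (simp add: g Q_def)
  have ratio_g: "ratio_mono M (dcoef (Suc n))"
    by (rule ratio_mono_step[OF P _ P_ratio]) (use n tri_ge gw in \<open>auto simp: M_def\<close>)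
  have coratio_g: "coratio_mono M (dcoef (Suc n))"
    by (rule coratio_mono_step[OF P P_coratio]) (use n tri_ge gw in \<open>auto simp: M_def\<close>)
  show "even_inv (Suc n)"
    using suppg ratio_g coratio_g by (simp add: even_inv_def M)
  have "ratio_mono N f"
  proof (rule ratio_mono_step[OF suppg _ ratio_g])
    fix k assume "k < N"
    then show "f k = wsum (Suc (Suc n)) (dcoef (Suc n)) k"
      unfolding h[symmetric] dcoef_Suc[of "Suc n"] by (simp add: N)
  qed (use n tri_ge in \<open>auto simp: N_def M_def\<close>)
  then show "odd_inv (Suc (Suc n))"
    using supp_f coratio_mono_f f_initial f_final unfolding odd_inv_def h N[symmetric] by simp
qed

section \<open>Base cases by explicit computation\<close>

lemma qint_monom_Suc: "(\<Sum>i\<le>Suc n. monom (1::int) i) = pCons 1 (\<Sum>i\<le>n. monom 1 i)"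
proof -
  have "(\<Sum>i\<le>n. monom (1::int) (Suc i)) = pCons 0 (\<Sum>i\<le>n. monom 1 i)"
    by (induction n) (simp_all add: monom_Suc)
  then show ?thesis
    by (simp add: sum.atMost_Suc_shift monom_0 del: sum.atMost_Suc)
qed

text \<open>For explicit coefficient lists the third premise is polynomial arithmetic that
  \<open>simp\<close> evaluates, so no derangements are enumerated.\<close>

lemma q_derangement_step:
  assumes "q_derangement m = p" "n = Suc m"
    and "(\<Sum>i\<le>m. monom 1 i) * p + (-1) ^ Suc m * monom 1 (Suc m choose 2) = p'"
  shows "q_derangement n = p'"
  using assms q_derangement_Suc[of m] by simp

lemma q_derangement_1: "q_derangement 1 = 0"
  by (rule q_derangement_step[OF q_derangement_0]) (simp_all add: monom_0 binomial_eq_0)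

lemma q_derangement_2: "q_derangement 2 = [:0, 1:]"
  by (rule q_derangement_step[OF q_derangement_1])
     (simp_all add: qint_monom_Suc monom_0 monom_Suc eval_nat_numeral)

lemma q_derangement_3: "q_derangement 3 = [:0, 1, 1:]"
  by (rule q_derangement_step[OF q_derangement_2])
     (simp_all add: qint_monom_Suc monom_0 monom_Suc eval_nat_numeral)

lemma q_derangement_4: "q_derangement 4 = [:0, 1, 2, 2, 2, 1, 1:]"
  by (rule q_derangement_step[OF q_derangement_3])
     (simp_all add: qint_monom_Suc monom_0 monom_Suc eval_nat_numeral)

lemma q_derangement_5: "q_derangement 5 = [:0, 1, 3, 5, 7, 8, 8, 6, 4, 2:]"
  by (rule q_derangement_step[OF q_derangement_4])
     (simp_all add: qint_monom_Suc monom_0 monom_Suc eval_nat_numeral)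

lemma q_derangement_6: "q_derangement 6 = [:0, 1, 4, 9, 16, 24, 32, 37, 38, 35, 28, 20, 12, 6, 2, 1:]"
  by (rule q_derangement_step[OF q_derangement_5])
     (simp_all add: qint_monom_Suc monom_0 monom_Suc eval_nat_numeral)

lemma q_derangement_7: "q_derangement 7 = [:0, 1, 5, 14, 30, 54, 86, 123, 160, 191, 210, 214, 202, 176, 141, 104, 69, 41, 21, 9, 3:]"
  by (rule q_derangement_step[OF q_derangement_6])
     (simp_all add: qint_monom_Suc monom_0 monom_Suc eval_nat_numeral)

lemma even_inv_6: "even_inv 6"
proof -
  have d: "dcoef 6 k = (if k < 0 then 0 else coeff [:0, 1, 4, 9, 16, 24, 32, 37, 38, 35, 28, 20, 12, 6, 2, 1:] (nat k))" for k
    by (simp add: dcoef_def q_derangement_6)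
  have tri: "tri 6 = 15"
    using two_tri[of 6] by simp
  have *: "k \<in> {1, 2, 3, 4, 5, 6, 7, 8, 9, 10, 11, 12, 13, 14, 15}"
    if "1 \<le> k" "k \<le> 15" for k :: int
    using that by (simp only: insert_iff empty_iff) presburger
  have v: "dcoef 6 1 = 1" "dcoef 6 2 = 4" "dcoef 6 3 = 9" "dcoef 6 4 = 16" "dcoef 6 5 = 24"
    "dcoef 6 6 = 32" "dcoef 6 7 = 37" "dcoef 6 8 = 38" "dcoef 6 9 = 35" "dcoef 6 10 = 28"
    "dcoef 6 11 = 20" "dcoef 6 12 = 12" "dcoef 6 13 = 6" "dcoef 6 14 = 2" "dcoef 6 15 = 1"
    by (simp_all add: d coeff_pCons')
  have out: "dcoef 6 k = 0" if "k \<le> 0 \<or> k > 15" for k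
    using that by (cases "k = 0") (auto simp: d intro!: coeff_eq_0)
  have "supp_pos 1 15 (dcoef 6)"
    unfolding supp_pos_def
  proof (intro allI)
    fix k :: int
    show "if 1 \<le> k \<and> k \<le> 15 then dcoef 6 k > 0 else dcoef 6 k = 0"
      using *[of k] out[of k] by (cases "1 \<le> k \<and> k \<le> 15") (auto simp: v)
  qed
  moreover have "ratio_mono 15 (dcoef 6)"
  proof (rule ratio_mono_halfI)
    fix k :: int assume "1 \<le> k" "2 * k \<le> 15 - 1"
    then show "dcoef 6 k * dcoef 6 (15 - k - 1) < dcoef 6 (k + 1) * dcoef 6 (15 - k)"
      using *[of k] by (auto simp: v)
  qed
  moreover have "coratio_mono 15 (dcoef 6)"
  proof (rule coratio_mono_halfI)
    fix k :: int assume "2 \<le> k" "2 * k \<le> 15"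
    then show "dcoef 6 (15 + 1 - k) * dcoef 6 (k + 1) < dcoef 6 (15 - k) * dcoef 6 k"
      using *[of k] by (auto simp: v)
  qed
  ultimately show ?thesis
    by (simp add: even_inv_def tri)
qed

lemma odd_inv_7: "odd_inv 7"
proof -
  have d: "dcoef 7 k = (if k < 0 then 0 else coeff [:0, 1, 5, 14, 30, 54, 86, 123, 160, 191, 210, 214, 202, 176, 141, 104, 69, 41, 21, 9, 3:] (nat k))" for k
    by (simp add: dcoef_def q_derangement_7)
  have tri: "tri 7 = 21"
    using two_tri[of 7] by simp
  have *: "k \<in> {1, 2, 3, 4, 5, 6, 7, 8, 9, 10, 11, 12, 13, 14, 15, 16, 17, 18, 19, 20}"
    if "1 \<le> k" "k \<le> 20" for k :: int
    using that by (simp only: insert_iff empty_iff) presburger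
  have v: "dcoef 7 1 = 1" "dcoef 7 2 = 5" "dcoef 7 3 = 14" "dcoef 7 4 = 30" "dcoef 7 5 = 54"
    "dcoef 7 6 = 86" "dcoef 7 7 = 123" "dcoef 7 8 = 160" "dcoef 7 9 = 191" "dcoef 7 10 = 210"
    "dcoef 7 11 = 214" "dcoef 7 12 = 202" "dcoef 7 13 = 176" "dcoef 7 14 = 141"
    "dcoef 7 15 = 104" "dcoef 7 16 = 69" "dcoef 7 17 = 41" "dcoef 7 18 = 21" "dcoef 7 19 = 9"
    "dcoef 7 20 = 3"
    by (simp_all add: d coeff_pCons')
  have out: "dcoef 7 k = 0" if "k \<le> 0 \<or> k > 20" for k
    using that by (cases "k = 0") (auto simp: d intro!: coeff_eq_0)
  have "supp_pos 1 20 (dcoef 7)"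
    unfolding supp_pos_def
  proof (intro allI)
    fix k :: int
    show "if 1 \<le> k \<and> k \<le> 20 then dcoef 7 k > 0 else dcoef 7 k = 0"
      using *[of k] out[of k] by (cases "1 \<le> k \<and> k \<le> 20") (auto simp: v)
  qed
  moreover have "ratio_mono 21 (dcoef 7)"
  proof (rule ratio_mono_halfI)
    fix k :: int assume "1 \<le> k" "2 * k \<le> 21 - 1"
    then show "dcoef 7 k * dcoef 7 (21 - k - 1) < dcoef 7 (k + 1) * dcoef 7 (21 - k)"
      using *[of k] by (auto simp: v)
  qed
  moreover have "coratio_mono 21 (dcoef 7)"
  proof (rule coratio_mono_halfI)
    fix k :: int assume "2 \<le> k" "2 * k \<le> 21"
    then show "dcoef 7 (21 + 1 - k) * dcoef 7 (k + 1) < dcoef 7 (21 - k) * dcoef 7 k"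
      using *[of k] by (auto simp: v)
  qed
  ultimately show ?thesis
    by (simp add: odd_inv_def tri v)
qed

lemma odd_inv: "odd_inv (2 * m + 7)"
proof (induction m)
  case 0
  then show ?case
    using odd_inv_7 by simp
next
  case (Suc m)
  then show ?case
    using inv_step(2)[of "2 * m + 7"] by simp
qed

lemma even_inv: "even_inv (2 * m + 6)"
proof (cases m)
  case 0
  then show ?thesis
    using even_inv_6 by simp
next
  case (Suc j)
  then show ?thesis
    using inv_step(1)[OF _ _ odd_inv[of j]] by simp
qed

section \<open>From cross products to ratios of real coefficients\<close>

lemma strict_mono_on_atLeastAtMostI:
  fixes g :: "nat \<Rightarrow> 'a::order"
  assumes "\<And>k. a \<le> k \<Longrightarrow> Suc k \<le> b \<Longrightarrow> g k < g (Suc k)"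
  shows "strict_mono_on {a..b} g"
proof (rule strict_mono_onI)
  fix i j assume "i \<in> {a..b}" "j \<in> {a..b}" "i < j"
  have "j \<le> b \<longrightarrow> i < j \<longrightarrow> g i < g j"
  proof (induction j)
    case (Suc j)
    then show ?case
      using assms[of j] \<open>i \<in> {a..b}\<close> by (auto simp: less_Suc_eq intro: less_trans)
  qed simp
  then show "g i < g j"
    using \<open>i < j\<close> \<open>j \<in> {a..b}\<close> by simp
qed

lemma degree_q_derangement:
  assumes "supp_pos 1 (int T) (dcoef n)" "T \<ge> 1"
  shows "degree (q_derangement n) = T"
proof (rule antisym)
  have d: "coeff (q_derangement n) k = dcoef n (int k)" for k
    by (simp add: dcoef_def)
  show "degree (q_derangement n) \<le> T"
    using supp_posD(3)[OF assms(1)] by (intro degree_le) (simp add: d)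
  have "coeff (q_derangement n) T > 0"
    unfolding d using supp_posD(1)[OF assms(1)] assms(2) by simp
  then show "T \<le> degree (q_derangement n)"
    by (intro le_degree) simp
qed

lemma q_derangement_invariant:
  assumes "n \<ge> 6"
  shows "supp_pos 1 (if even n then tri n else tri n - 1) (dcoef n) \<and> ratio_mono (tri n) (dcoef n) \<and> coratio_mono (tri n) (dcoef n)"
proof (cases "even n")
  case True
  hence "\<exists>m. n = 2 * m + 6"
    using assms by presburger
  then show ?thesis
    using True even_inv by (auto simp: even_inv_def)
next
  case False
  hence "\<exists>m. n = 2 * m + 7"
    using assms by presburger
  then show ?thesis
    using False odd_inv by (auto simp: odd_inv_def)
qed

lemma ratio_monotone:
  fixes a :: "nat \<Rightarrow> real"
  assumes pos: "\<And>k. 1 \<le> k \<Longrightarrow> k < N \<Longrightarrow> a k > 0"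
    and c1: "\<And>k. 1 \<le> k \<Longrightarrow> k + 2 \<le> N \<Longrightarrow> a k * a (N - k - 1) < a (k + 1) * a (N - k)"
    and c2: "\<And>k. 2 \<le> k \<Longrightarrow> k + 2 \<le> N \<Longrightarrow> a (N + 1 - k) * a (k + 1) < a (N - k) * a k"
  shows "2 * s < N \<Longrightarrow> strict_mono_on {1..s} (\<lambda>k. a k / a (N - k))"
    and "2 * s \<le> N \<Longrightarrow> strict_mono_on {2..s} (\<lambda>k. a (N + 1 - k) / a k)"
proof -
  assume s: "2 * s < N"
  show "strict_mono_on {1..s} (\<lambda>k. a k / a (N - k))"
  proof (rule strict_mono_on_atLeastAtMostI)
    fix k assume k: "1 \<le> k" "Suc k \<le> s"
    have "a (N - k) > 0" "a (N - k - 1) > 0"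
      using k s by (auto intro!: pos)
    then show "a k / a (N - k) < a (Suc k) / a (N - Suc k)"
      using c1[of k] k s by (simp add: divide_simps)
  qed
next
  assume s: "2 * s \<le> N"
  show "strict_mono_on {2..s} (\<lambda>k. a (N + 1 - k) / a k)"
  proof (rule strict_mono_on_atLeastAtMostI)
    fix k assume k: "2 \<le> k" "Suc k \<le> s"
    have "a k > 0" "a (k + 1) > 0"
      using k s by (auto intro!: pos)
    then show "a (N + 1 - k) / a k < a (N + 1 - Suc k) / a (Suc k)"
      using c2[of k] k s by (simp add: divide_simps)
  qed
qed

theorem theorem1:
  fixes n \<beta> :: nat and A :: "nat \<Rightarrow> real"
  assumes "n \<ge> 6"
    and "\<beta> = degree (q_derangement n)"
    and "A = (\<lambda>k. real_of_int (coeff (q_derangement n) k))"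
  shows
    "(n mod 4 = 1 \<longrightarrow>
       (let r = n * (n - 1) div 4 in
          strict_mono_on {1..r - 1} (\<lambda>k. A k / A (\<beta> + 1 - k)) \<and>
          A (r - 1) / A (r + 1) < 1 \<and>
          strict_mono_on {2..r} (\<lambda>k. A (\<beta> + 2 - k) / A k) \<and>
          A (r + 1) / A r < 1)) \<and>
     (n mod 4 = 2 \<longrightarrow>
       (let r = (n * (n - 1) - 2) div 4 in
          strict_mono_on {1..r} (\<lambda>k. A k / A (\<beta> - k)) \<and>
          A r / A (r + 1) < 1 \<and>
          strict_mono_on {2..r} (\<lambda>k. A (\<beta> + 1 - k) / A k) \<and>
          A (r + 2) / A r < 1)) \<and>
     (n mod 4 = 3 \<longrightarrow>
       (let r = (n * (n - 1) - 2) div 4 in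
          strict_mono_on {1..r} (\<lambda>k. A k / A (\<beta> + 1 - k)) \<and>
          A r / A (r + 1) < 1 \<and>
          strict_mono_on {2..r} (\<lambda>k. A (\<beta> + 2 - k) / A k) \<and>
          A (r + 2) / A r < 1)) \<and>
     (n mod 4 = 0 \<longrightarrow>
       (let r = n * (n - 1) div 4 in
          strict_mono_on {1..r - 1} (\<lambda>k. A k / A (\<beta> - k)) \<and>
          A (r - 1) / A (r + 1) < 1 \<and>
          strict_mono_on {2..r} (\<lambda>k. A (\<beta> + 1 - k) / A k) \<and>
          A (r + 1) / A r < 1))"
proof -
  define N where "N = n choose 2"
  have A: "A k = real_of_int (dcoef n (int k))" for k
    by (simp add: assms(3) dcoef_def)
  note inv = q_derangement_invariant[OF assms(1)]
  have tri: "tri n = int N"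
    by (simp add: tri_def N_def)
  have "int (2 * N) = int (n * (n - 1))"
    using two_tri[of n] assms(1) by (simp add: tri of_nat_diff)
  hence N: "2 * N = n * (n - 1)"
    unfolding of_nat_eq_iff .
  have "n * 5 \<le> n * (n - 1)"
    using assms(1) by (intro mult_left_mono) auto
  hence N15: "N \<ge> 15"
    using N assms(1) by linarith
  \<comment> \<open>Hence \<open>\<beta> - k\<close> for even \<open>n\<close> and
    \<open>\<beta> + 1 - k\<close> for odd \<open>n\<close> both equal \<open>N - k\<close>; the
    residue modulo 4 then only fixes the parity of \<open>N\<close>.\<close>
  have \<beta>: "\<beta> = (if even n then N else N - 1)"
    unfolding assms(2)
    by (rule degree_q_derangement) (use inv N15 in \<open>auto simp: tri of_nat_diff\<close>)
  have pos: "A k > 0" if "1 \<le> k" "k < N" for k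
    using supp_posD(1)[of 1 _ "dcoef n" "int k"] inv that by (auto simp: A tri split: if_splits)
  have c1: "A k * A (N - k - 1) < A (k + 1) * A (N - k)" if "1 \<le> k" "k + 2 \<le> N" for k
  proof -
    have "dcoef n (int k) * dcoef n (int N - int k - 1) < dcoef n (int k + 1) * dcoef n (int N - int k)"
      using inv that by (auto simp: ratio_mono_def tri)
    then show ?thesis
      using that by (simp add: A of_nat_diff algebra_simps flip: of_int_mult)
  qed
  have c2: "A (N + 1 - k) * A (k + 1) < A (N - k) * A k" if "2 \<le> k" "k + 2 \<le> N" for k
  proof -
    have "dcoef n (int N + 1 - int k) * dcoef n (int k + 1) < dcoef n (int N - int k) * dcoef n (int k)"
      using inv that by (auto simp: coratio_mono_def tri)
    then show ?thesis
      using that by (simp add: A of_nat_diff algebra_simps flip: of_int_mult)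
  qed
  note mono1 = ratio_monotone(1)[of N A, OF pos c1 c2] and mono2 = ratio_monotone(2)[of N A, OF pos c1 c2]
  have last_even: "A (r - 1) / A (r + 1) < 1 \<and> A (r + 1) / A r < 1" if r: "N = 2 * r" for r
  proof -
    have "r \<ge> 3"
      using N15 r by simp
    \<comment> \<open>In the middle the cross products either share a factor, which cancels, or
      become squares; this gives the final comparisons with 1.\<close>
    hence 1: "A r * A (r - 1) < A r * A (r + 1)" and 2: "A (r + 1) * A (r + 1) < A r * A r"
      using c1[of "r - 1"] c2[of r] r by (simp_all add: mult.commute)
    have "A r > 0" "A (r + 1) > 0"
      using r \<open>r \<ge> 3\<close> by (auto intro!: pos)
    then show ?thesis
      using 1 power2_less_imp_less[of "A (r + 1)" "A r"] 2 by (simp add: power2_eq_square)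
  qed
  have last_odd: "A r / A (r + 1) < 1 \<and> A (r + 2) / A r < 1" if r: "N = 2 * r + 1" for r
  proof -
    have "r \<ge> 3"
      using N15 r by simp
    hence 1: "A r * A r < A (r + 1) * A (r + 1)" and 2: "A (r + 1) * A (r + 2) < A (r + 1) * A r"
      using c1[of r] c2[of r] r by (simp_all add: mult.commute)
    have "A r > 0" "A (r + 1) > 0"
      using r \<open>r \<ge> 3\<close> by (auto intro!: pos)
    then show ?thesis
      using power2_less_imp_less[of "A r" "A (r + 1)"] 1 2 by (simp add: power2_eq_square)
  qed
  have r0: "n * (n - 1) div 4 = N div 2" "(n * (n - 1) - 2) div 4 = (N - 1) div 2"
    using N N15 by linarith+
  define m where "m = n div 4"
  consider "n mod 4 = 0" | "n mod 4 = 1" | "n mod 4 = 2" | "n mod 4 = 3"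
    by linarith
  then show ?thesis
  proof cases
    case 1
    hence n: "n = 4 * m"
      unfolding m_def by presburger
    have "N = 2 * (m * (n - 1))"
      using N by (simp add: n)
    then obtain r where r: "N = 2 * r" ..
    have "n * (n - 1) div 4 = r" "\<beta> = N"
      using r0 r \<beta> n by auto
    then show ?thesis
      using 1 mono1[of "r - 1"] mono2[of r] last_even[OF r] r N15 by (simp add: Let_def)
  next
    case 2
    hence n: "n = 4 * m + 1"
      unfolding m_def by presburger
    have "N = 2 * (m * n)"
      using N by (simp add: n)
    then obtain r where r: "N = 2 * r" ..
    have "n * (n - 1) div 4 = r" and \<beta>': "\<beta> + 1 = N" "\<beta> + 2 = N + 1"
      using r0 r \<beta> n N15 by auto
    then show ?thesis
      unfolding \<beta>' using 2 mono1[of "r - 1"] mono2[of r] last_even[OF r] r N15 by (simp add: Let_def)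
  next
    case 3
    hence n: "n = 4 * m + 2"
      unfolding m_def by presburger
    have "N = (2 * m + 1) * (4 * m + 1)"
      using N by (simp add: n)
    hence "odd N"
      by simp
    then obtain r where r: "N = 2 * r + 1" ..
    have "(n * (n - 1) - 2) div 4 = r" "\<beta> = N"
      using r0 r \<beta> n by auto
    then show ?thesis
      using 3 mono1[of r] mono2[of r] last_odd[OF r] r N15 by (simp add: Let_def)
  next
    case 4
    hence n: "n = 4 * m + 3"
      unfolding m_def by presburger
    have "N = (2 * m + 1) * (4 * m + 3)"
      using N by (simp add: n algebra_simps)
    hence "odd N"
      by simp
    then obtain r where r: "N = 2 * r + 1" ..
    have "(n * (n - 1) - 2) div 4 = r" and \<beta>': "\<beta> + 1 = N" "\<beta> + 2 = N + 1"
      using r0 r \<beta> n N15 by auto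
    then show ?thesis
      unfolding \<beta>' using 4 mono1[of r] mono2[of r] last_odd[OF r] r N15 by (simp add: Let_def)
  qed
qed

end
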